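(* Let $I_1$ be the (rescaled) non-trivial action of the champagne bottle near its focus-focus point, expressed in terms of the normal-form momenta $(j_1,j_2)$ near $(0,0)$, and let $\hat j=j_1+ij_2$. Then $$2\pi I_1=\frac43-\pi|j_2|+j_2\arg\hat j-j_1\ln|\hat j|+j_1+S(j_1,j_2),$$ where the semi-global symplectic invariant $S$ has the expansion $$S(j_1,j_2)=j_1\ln16+\frac1{16}(17j_1^2+3j_2^2)-\frac{j_1}{128}(125j_1^2+43j_2^2)+\ldots .$$
   Context: Setting: the champagne bottle Hamiltonian $H=\frac12(y_1^2+y_2^2)-(x_1^2+x_2^2)+(x_1^2+x_2^2)^2$ on $\mathbb{R}^4$ with angular momentum $\ell$-integral $x_1y_2-x_2y_1$, whose origin is a simple focus-focus point. For energy $h$ and angular momentum value $\ell$, set $j_2=\sqrt2\,\ell$ and let $I_1(h,j_2)=\frac{\sqrt2}{2\pi}\int_{z_2}^{z_3}\frac{\sqrt{P(z)}}{z}dz$, where $P(z)=-2z^3+2z^2+2hz-\frac{j_2^2}{2}$ and $z_2<z_3$ are its two largest real roots (this is $\sqrt2$ times the radial action $\frac1{2\pi}\oint p_r\,dr$). The coordinate $j_1$ is defined near $(0,0)$ by $h=\overline{H}(j_1,j_2)$, where $\overline{H}$ is the rescaled Birkhoff normal form $$\overline H(J_1,J_2)=J_1+\frac18(3J_1^2+J_2^2)-\frac1{64}J_1(17J_1^2+9J_2^2)+\frac1{1024}(375J_1^4+258J_1^2J_2^2+11J_2^4)-\frac1{16384}J_1(10689J_1^4+8910J_1^2J_2^2+909J_2^4)+\ldots$$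 (equivalently $j_1=h-\frac18(3h^2+j_2^2)+\frac h{64}(35h^2+15j_2^2)-\ldots$). Following V\~u Ng\d{o}c, the semi-global symplectic invariant of a simple focus-focus singularity is the smooth function $S$ in the decomposition $2\pi I_1=2\pi I_{10}-\mathrm{Re}(\hat j\ln\hat j-\hat j)+S(j_1,j_2)$ of the non-trivial action, with $I_{10}$ a constant (and the non-smooth $j_2$-dependent terms). *)

theory Defs
  imports "HOL-Analysis.Analysis" "HOL-Library.Landau_Symbols"
begin

definition Pcub :: "real \<Rightarrow> real \<Rightarrow> real \<Rightarrow> real" where
  "Pcub h j2 z = -2*z^3 + 2*z^2 + 2*h*z - j2^2/2"

definition zroot3 :: "real \<Rightarrow> real \<Rightarrow> real" where
  "zroot3 h j2 = Max {z. Pcub h j2 z = 0}"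

definition zroot2 :: "real \<Rightarrow> real \<Rightarrow> real" where
  "zroot2 h j2 = Max ({z. Pcub h j2 z = 0} - {zroot3 h j2})"

definition I1 :: "real \<Rightarrow> real \<Rightarrow> real" where
  "I1 h j2 = sqrt 2 / (2*pi) *
     integral {zroot2 h j2 .. zroot3 h j2} (\<lambda>z. sqrt (Pcub h j2 z) / z)"

text \<open>Degree <= 5 truncation of the rescaled Birkhoff normal form.\<close>
definition Hbar5 :: "real \<Rightarrow> real \<Rightarrow> real" where
  "Hbar5 J1 J2 = J1 + (3*J1^2 + J2^2)/8 - J1*(17*J1^2 + 9*J2^2)/64
     + (375*J1^4 + 258*J1^2*J2^2 + 11*J2^4)/1024
     - J1*(10689*J1^4 + 8910*J1^2*J2^2 + 909*J2^4)/16384"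

definition Sinv :: "(real \<Rightarrow> real \<Rightarrow> real) \<Rightarrow> real \<Rightarrow> real \<Rightarrow> real" where
  "Sinv Hb j1 j2 = 2*pi * I1 (Hb j1 j2) j2
     - (4/3 - pi*\<bar>j2\<bar> + j2 * Arg (Complex j1 j2) - j1 * ln (cmod (Complex j1 j2)) + j1)"

end

theory Submission
  imports Defs
begin

text \<open>
  Write \<open>m = z\<^sub>3 powr (- 1/2)\<close> for the largest root \<open>z\<^sub>3\<close> of the cubic and substitute \<open>z = u / m\<^sup>2\<close>.
  The action becomes \<open>2 / m\<^sup>3\<close> times the integral of \<open>sqrt (1 - u) * sqrt (u\<^sup>2 - t * u - q\<^sup>2) / u\<close> from the
  larger root of the quadratic to 1, where \<open>t = m\<^sup>2 - 1\<close> and \<open>q = \<bar>j\<^sub>2\<bar> * m\<^sup>3 / 2\<close> are small and the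
  energy is a rational function of \<open>m\<close> and \<open>j\<^sub>2\<close>. Replacing \<open>sqrt (1 - u)\<close> by its cubic Taylor polynomial
  makes the integral elementary; it contributes all logarithms and angles. The remainder is
  \<open>O(u\<^sup>4)\<close>, so in it the other square root can be expanded in \<open>t / u + q\<^sup>2 / u\<^sup>2\<close> under the integral.

  The coefficient of the logarithm agrees with \<open>j\<^sub>1\<close> to fifth order, because the Birkhoff normal form inverts
  it. Logarithm and angle are the real and imaginary parts of \<open>Ln\<close> at an explicit point
  \<open>w\<close> near \<open>j\<^sub>1 + \<i> * j\<^sub>2\<close>, and the ratio of the two points is a smooth unit, so passing from one
  to the other only costs a polynomial. What is left is a polynomial identity in \<open>m - 1\<close> and \<open>j\<^sub>2\<close>.
\<close>

section \<open>Taylor remainder of the square root\<close>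

text \<open>At the focus-focus point both roots of the quadratic merge with the pole
  \<open>u = 0\<close>. A direct expansion of its square root fails, because
  \<open>t / u + q^2 / u^2\<close> equals 1 at the lower limit, however small \<open>t\<close> and
  \<open>q\<close> are. Subtracting a cubic polynomial is just enough: terms of degree at most three
  in \<open>(t, q)\<close> have poles of order at most three, and the fourth-order error, with its
  \<open>1 / u^4\<close>, is absorbed by \<open>u^4\<close>. The point \<open>w\<close> is dictated
  by the elementary part: its modulus is the \<open>sqrt (t^2 + 4 * q^2)\<close> inside the
  logarithm, and the cosine of its argument is minus the argument of the arccosine. The coefficient
  of the logarithm has to match \<open>j1\<close> one order beyond the claimed error, since the
  mismatch gets multiplied by the unbounded \<open>ln (cmod w)\<close>. Working with the absolute
  value of \<open>j2\<close> is possible because everything is even in \<open>j2\<close>; it makes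
  \<open>q\<close> nonnegative and keeps both complex points in the closed upper half-plane, where
  the principal argument has no jump. Using \<open>m\<close> in place of the root itself avoids
  fractional powers.\<close>

definition sqrt_taylor :: "real \<Rightarrow> real" where
  "sqrt_taylor x = 1 - x/2 - x^2/8 - x^3/16"

text \<open>With \<open>x = 1 - s^2\<close> the remainder is a polynomial in \<open>s\<close> with a
  fourfold zero at \<open>s = 1\<close>, that is, at \<open>x = 0\<close>. The exact form serves
  both the error bound and the computation of moments.\<close>

lemma sqrt_taylor_remainder:
  fixes x :: real
  assumes "x \<le> 1"
  defines "s \<equiv> sqrt (1 - x)"
  shows "s - sqrt_taylor x = - ((1 - s)^4 * (s^2 + 4 * s + 5) / 16)"
proof -
  have x: "x = 1 - s^2" using assms by simp
  show ?thesis unfolding sqrt_taylor_def x by (simp add: field_simps) algebra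
qed

text \<open>Follows from \<open>x = (1 - s) * (1 + s)\<close> and the comparison of the quadratic
  factor with \<open>(1 + s)^4\<close>. Negative \<open>x\<close> must be covered, because
  \<open>t / u + q^2 / u^2\<close> can be negative.\<close>

lemma sqrt_taylor_error:
  fixes x :: real
  assumes "x \<le> 1"
  shows "\<bar>sqrt (1 - x) - sqrt_taylor x\<bar> \<le> x^4"
proof -
  define s where "s = sqrt (1 - x)"
  have s: "s \<ge> 0" "x = 1 - s^2" using assms by (auto simp: s_def)
  have "(1 - s)^4 * (s^2 + 4 * s + 5) / 16 \<le> (1 - s)^4 * (1 + s)^4"
  proof -
    have "(s^2 + 4 * s + 5) / 16 \<le> (1 + s)^4"
      using s(1) by (simp add: power4_eq_xxxx power2_eq_square algebra_simps)
    from mult_left_mono[OF this, of "(1 - s)^4"] show ?thesis by simp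
  qed
  also have "(1 - s)^4 * (1 + s)^4 = x^4"
    unfolding s(2) by (simp add: power_mult_distrib[symmetric] power2_eq_square algebra_simps)
  finally show ?thesis
    using sqrt_taylor_remainder[OF assms] s(1) by (simp add: s_def[symmetric] abs_mult)
qed

lemma sqrt_taylor_error_unit:
  fixes u :: real
  assumes "0 \<le> u" "u \<le> 1"
  shows "\<bar>sqrt (1 - u) - sqrt_taylor u\<bar> \<le> u^4"
  using sqrt_taylor_error assms by simp

text \<open>The substitution \<open>u = 1 - s^2\<close>. The derivative is asked for only in the
  interior, since \<open>sqrt (1 - u)\<close> is not differentiable at \<open>u = 1\<close> and the
  integrands below divide by \<open>u\<close>.\<close>

lemma has_integral_sqrt_substitution:
  fixes N f :: "real \<Rightarrow> real"
  assumes cont: "continuous_on {0..1} N"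
    and deriv: "\<And>s. 0 < s \<Longrightarrow> s < 1 \<Longrightarrow> (N has_real_derivative (- 2 *
        s * f (1 - s^2))) (at s)"
  shows "(f has_integral (N 0 - N 1)) {0..1}"
proof -
  have "(f has_integral (N (sqrt (1 - 1)) - N (sqrt (1 - 0)))) {0..1}"
  proof (rule fundamental_theorem_of_calculus_interior)
    show "continuous_on {0..1} (\<lambda>u. N (sqrt (1 - u)))"
      by (rule continuous_on_compose2[OF cont]) (auto intro!: continuous_intros)
    fix u :: real assume u: "u \<in> {0<..<1}"
    then have "sqrt (1 - u) < 1" "0 < sqrt (1 - u)" by auto
    have "((\<lambda>u. sqrt (1 - u)) has_real_derivative - (inverse (sqrt (1 - u)) / 2)) (at u)"
      using u by (auto intro!: derivative_eq_intros simp: field_simps)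
    from DERIV_chain2[where f = N, OF deriv[of "sqrt (1 - u)"] this] u
    have "((\<lambda>u. N (sqrt (1 - u))) has_real_derivative f u) (at u)"
      by (simp add: field_simps)
    then show "((\<lambda>u. N (sqrt (1 - u))) has_vector_derivative f u) (at u)"
      by (simp add: has_real_derivative_iff_has_vector_derivative)
  qed auto
  then show ?thesis by simp
qed

text \<open>The fourfold zero at \<open>u = 0\<close> makes division by \<open>u^k\<close> harmless
  for \<open>k \<le> 3\<close>. In terms of \<open>s\<close> the integrands are rational with
  denominator a power of \<open>1 + s\<close>, so the antiderivatives are written in powers of
  \<open>1 + s\<close>; the terms in \<open>1 / (1 + s)\<close> produce \<open>ln 2\<close>.\<close>

lemma sqrt_taylor_moments:
  defines "g \<equiv> \<lambda>u. sqrt (1 - u) - sqrt_taylor u"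
  shows "(g has_integral (-5/192)) {0..1}"
    and "((\<lambda>u. g u / u) has_integral (2 * ln 2 - 17/12)) {0..1}"
    and "((\<lambda>u. g u / u^2) has_integral (21/32 - ln 2)) {0..1}"
    and "((\<lambda>u. g u / u^3) has_integral (1/8 - ln 2 / 4)) {0..1}"
proof -
  have g: "g (1 - s^2) = - ((1 - s)^4 * (s^2 + 4 * s + 5) / 16)" if "0 < s" for s :: real
    using sqrt_taylor_remainder[of "1 - s^2"] that by (simp add: g_def)
  have gk: "g (1 - s^2) / (1 - s^2)^k = - ((1 - s)^(4 - k) * (s^2 + 4 * s + 5) / (16 * (1 + s)^k))"
    if "0 < s" "s < 1" "k \<le> 4" for s :: real and k
  proof -
    have "(1 - s^2)^k = (1 - s)^k * (1 + s)^k"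
      by (simp add: power_mult_distrib[symmetric] power2_eq_square algebra_simps)
    moreover have "(1 - s)^4 = (1 - s)^(4 - k) * (1 - s)^k"
      using that by (simp flip: power_add)
    ultimately show ?thesis using that by (simp add: g)
  qed
  have gk': "-2 * s * (g (1 - s^2) / (1 - s^2)^k) = s * ((1 - s)^(4 - k) * (s^2 + 4 * s
      + 5)) / (8 * (1 + s)^k)"
    if "0 < s" "s < 1" "k \<le> 4" for s :: real and k
    unfolding gk[OF that] using that by (simp add: field_simps)
  define N0 :: "real \<Rightarrow> real" where
    "N0 = (\<lambda>s. - (4*(1+s) - 4*(1+s)^2 + 4/3*(1+s)^3 + (1+s)^5/4 - (1+s)^6/3 + (1+s)^7/8
        - (1+s)^8/64))"
  have "(g has_integral (N0 0 - N0 1)) {0..1}"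
  proof (rule has_integral_sqrt_substitution)
    show "continuous_on {0..1} N0" unfolding N0_def by (intro continuous_intros) auto
    fix s :: real assume s: "0 < s" "s < 1"
    have e: "-2 * s * g (1 - s^2) = s * ((1 - s)^4 * (s^2 + 4 * s + 5)) / 8"
      using gk[OF s, of 0] by simp
    show "(N0 has_real_derivative (-2 * s * g (1 - s^2))) (at s)"
      unfolding e N0_def
      by (auto intro!: derivative_eq_intros) (simp add: eval_nat_numeral field_simps)
  qed
  then show "(g has_integral (-5/192)) {0..1}" by (simp add: N0_def)
  define N1 :: "real \<Rightarrow> real" where
    "N1 = (\<lambda>s. - (2 * ln (1+s) - 3*(1+s) + (1+s)^2/4 + (1+s)^3/12 + 3/16*(1+s)^4 - (1+s)^5/8
        + (1+s)^6/48))"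
  have "((\<lambda>u. g u / u) has_integral (N1 0 - N1 1)) {0..1}"
  proof (rule has_integral_sqrt_substitution)
    show "continuous_on {0..1} N1" unfolding N1_def by (intro continuous_intros) auto
    fix s :: real assume s: "0 < s" "s < 1"
    have e: "-2 * s * (g (1 - s^2) / (1 - s^2)) = s * ((1 - s)^3 * (s^2 + 4 * s + 5)) / (8 * (1 + s))"
      using gk'[OF s, of 1] by simp
    show "(N1 has_real_derivative (-2 * s * (g (1 - s^2) / (1 - s^2)))) (at s)"
    proof -
      define v where "v = 1 + s"
      then have v: "s = v - 1" "v > 0" using s by auto
      show ?thesis unfolding e N1_def unfolding v(1) using v(2)
        by (auto intro!: derivative_eq_intros) (simp add: eval_nat_numeral field_simps)
    qed
  qed
  then show "((\<lambda>u. g u / u) has_integral (2 * ln 2 - 17/12)) {0..1}" by (simp add: N1_def)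
  define N2 :: "real \<Rightarrow> real" where
    "N2 = (\<lambda>s. - (- 1 / (1+s) - ln (1+s) - (1+s)/4 + (1+s)^3/8 - (1+s)^4/32))"
  have "((\<lambda>u. g u / u^2) has_integral (N2 0 - N2 1)) {0..1}"
  proof (rule has_integral_sqrt_substitution)
    show "continuous_on {0..1} N2" unfolding N2_def by (intro continuous_intros) auto
    fix s :: real assume s: "0 < s" "s < 1"
    have e: "-2 * s * (g (1 - s^2) / (1 - s^2)^2) = s * ((1 - s)^2 * (s^2 + 4 * s + 5)) / (8 * (1 + s)^2)"
      using gk'[OF s, of 2] by simp
    show "(N2 has_real_derivative (-2 * s * (g (1 - s^2) / (1 - s^2)^2))) (at s)"
    proof -
      define v where "v = 1 + s"
      then have v: "s = v - 1" "v > 0" using s by auto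
      show ?thesis unfolding e N2_def unfolding v(1) using v(2)
        by (auto intro!: derivative_eq_intros) (simp add: eval_nat_numeral field_simps)
    qed
  qed
  then show "((\<lambda>u. g u / u^2) has_integral (21/32 - ln 2)) {0..1}" by (simp add: N2_def)
  define N3 :: "real \<Rightarrow> real" where
    "N3 = (\<lambda>s. - (- 1 / (4 * (1+s)^2) + 1 / (4 * (1+s)) - ln (1+s) / 4 - (1+s)/8 + (1+s)^2/16))"
  have "((\<lambda>u. g u / u^3) has_integral (N3 0 - N3 1)) {0..1}"
  proof (rule has_integral_sqrt_substitution)
    show "continuous_on {0..1} N3" unfolding N3_def by (intro continuous_intros) auto
    fix s :: real assume s: "0 < s" "s < 1"
    have e: "-2 * s * (g (1 - s^2) / (1 - s^2)^3) = s * ((1 - s) * (s^2 + 4 * s + 5)) / (8 * (1 + s)^3)"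
      using gk'[OF s, of 3] by simp
    show "(N3 has_real_derivative (-2 * s * (g (1 - s^2) / (1 - s^2)^3))) (at s)"
    proof -
      define v where "v = 1 + s"
      then have v: "s = v - 1" "v > 0" using s by auto
      show ?thesis unfolding e N3_def unfolding v(1) using v(2)
        by (auto intro!: derivative_eq_intros) (simp add: eval_nat_numeral field_simps)
    qed
  qed
  then show "((\<lambda>u. g u / u^3) has_integral (1/8 - ln 2 / 4)) {0..1}" by (simp add: N3_def)
qed

section \<open>The elementary part of the integral\<close>

definition quad :: "real \<Rightarrow> real \<Rightarrow> real \<Rightarrow> real" where
  "quad t q u = u^2 - t * u - q^2"

definition quad_disc :: "real \<Rightarrow> real \<Rightarrow> real" where
  "quad_disc t q = sqrt (t^2 + 4 * q^2)"

definition quad_root :: "real \<Rightarrow> real \<Rightarrow> real" where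
  "quad_root t q = (t + quad_disc t q) / 2"

definition elliptic_integral :: "real \<Rightarrow> real \<Rightarrow> real" where
  "elliptic_integral t q = integral {quad_root t q..1} (\<lambda>u. sqrt (1 - u) * sqrt (quad t q u) / u)"

definition log_coeff :: "real \<Rightarrow> real \<Rightarrow> real" where
  "log_coeff t Q = - t/2 + Q/4 + t^2/16 + t * Q/32 + Q^2/128 + t^3/128 + 3/256 * t^2 * Q + 5/2048 * t^4"

text \<open>Together with \<open>log_coeff\<close>, found by comparing coefficients in the differentiated form of
  \<open>has_integral_sqrt_taylor_quad\<close>; in both, \<open>Q\<close> stands for \<open>q\<^sup>2\<close>.\<close>

definition sqrt_coeff :: "real \<Rightarrow> real \<Rightarrow> real \<Rightarrow> real" where
  "sqrt_coeff t Q u = (1 + Q/24 + t/8 + 13/768 * t * Q + t^2/64 + 5/1024 * t^3)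
     + (- 1/4 + Q/128 + t/96 + 5/1536 * t^2) * u + (- 1/24 + t/384) * u^2 - u^3/64"

lemma quad_disc_ge: "\<bar>t\<bar> \<le> quad_disc t q"
  unfolding quad_disc_def by (rule real_le_rsqrt) simp

lemma quad_disc_le: "q \<ge> 0 \<Longrightarrow> quad_disc t q \<le> \<bar>t\<bar> + 2 * q"
  unfolding quad_disc_def by (rule real_le_lsqrt) (auto simp: power2_eq_square algebra_simps)

lemma quad_disc_sq: "(quad_disc t q)^2 = t^2 + 4 * q^2"
  by (simp add: quad_disc_def)

lemma quad_factor: "quad t q u = (u - quad_root t q) * (u + (quad_disc t q - t) / 2)"
  using quad_disc_sq[of t q]
  by (simp add: quad_def quad_root_def field_simps power2_eq_square)

lemma quad_root_nonneg: "quad_root t q \<ge> 0"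
  using quad_disc_ge[of t q] by (simp add: quad_root_def)

lemma quad_root_less_one:
  assumes "t + q^2 < 1"
  shows "quad_root t q < 1"
proof (rule ccontr)
  assume "\<not> ?thesis"
  then have "quad t q 1 \<le> 0"
    unfolding quad_factor using quad_disc_ge[of t q] by (intro mult_nonpos_nonneg) auto
  with assms show False by (simp add: quad_def)
qed

lemma quad_nonneg: "quad_root t q \<le> u \<Longrightarrow> quad t q u \<ge> 0"
  unfolding quad_factor using quad_disc_ge[of t q] quad_root_nonneg[of t q] by (intro
      mult_nonneg_nonneg) auto

lemma quad_pos:
  assumes "quad_disc t q > 0" "quad_root t q < u"
  shows "quad t q u > 0"
proof -
  have "u + (quad_disc t q - t) / 2 > 0"
    using assms by (simp add: quad_root_def field_simps)
  then show ?thesis unfolding quad_factor using assms by (intro mult_pos_pos) auto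
qed

lemma quad_root_pos: "q \<noteq> 0 \<Longrightarrow> quad_root t q > 0"
proof -
  assume "q \<noteq> 0"
  then have "sqrt (t^2) < quad_disc t q" unfolding quad_disc_def by (intro real_sqrt_less_mono) simp
  then show ?thesis by (simp add: quad_root_def)
qed

text \<open>Makes the arcsine of this quantity an antiderivative of
  \<open>- q / (u * sqrt (quad t q u))\<close> for positive \<open>q\<close>, which accounts for the
  pole of the integrand at \<open>u = 0\<close>.\<close>

lemma arcsin_arg:
  assumes "u > 0" "quad_disc t q > 0"
  shows "1 - ((t * u + 2 * q^2) / (u * quad_disc t q))^2 = 4 * q^2 * quad t q u / (u * quad_disc t q)^2"
proof -
  have "(u * quad_disc t q)^2 - (t * u + 2 * q^2)^2 = 4 * q^2 * quad t q u"
    unfolding power_mult_distrib quad_disc_sq by (simp add: quad_def power2_eq_square algebra_simps)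
  then show ?thesis using assms by (simp add: power_divide diff_divide_eq_iff)
qed

lemma arcsin_arg_bounds:
  assumes "u > 0" "quad_disc t q > 0" "quad_root t q \<le> u"
  shows "\<bar>(t * u + 2 * q^2) / (u * quad_disc t q)\<bar> \<le> 1"
proof -
  have "1 - ((t * u + 2 * q^2) / (u * quad_disc t q))^2 \<ge> 0"
    unfolding arcsin_arg[OF assms(1,2)] using quad_nonneg[OF assms(3)] by simp
  then show ?thesis by (simp add: abs_square_le_1)
qed

lemma has_integral_sqrt_taylor_quad:
  assumes q: "q \<ge> 0" and tq: "t + q^2 < 1" and \<rho>: "quad_disc t q > 0"
  shows "((\<lambda>u. sqrt_taylor u * sqrt (quad t q u) / u) has_integral
    (sqrt_coeff t (q^2) 1 * sqrt (1 - t - q^2)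
     + log_coeff t (q^2) * (ln (2 - t + 2 * sqrt (1 - t - q^2)) - ln (quad_disc t q))
     - q * arccos ((t + 2 * q^2) / quad_disc t q))) {quad_root t q..1}"
proof -
  let ?\<rho> = "quad_disc t q" and ?r = "quad_root t q" and ?Q = "q^2"
  define y where "y = (\<lambda>u. (t * u + 2 * q^2) / (u * ?\<rho>))"
  define \<Phi> where "\<Phi> = (\<lambda>u. sqrt_coeff t ?Q u * sqrt (quad t q u)
      + log_coeff t ?Q * ln (2 * u - t + 2 * sqrt (quad t q u)) + q * arcsin (y u))"
  have r: "0 \<le> ?r" "?r < 1" using quad_root_nonneg quad_root_less_one[OF tq] by auto
  have lnpos: "2 * u - t + 2 * sqrt (quad t q u) > 0" if "?r \<le> u" for u
    using quad_nonneg[OF that] that \<rho>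
    by (intro add_pos_nonneg) (auto simp: quad_root_def)
  have "((\<lambda>u. sqrt_taylor u * sqrt (quad t q u) / u) has_integral (\<Phi> 1 - \<Phi> ?r)) {?r..1}"
  proof (rule fundamental_theorem_of_calculus_interior)
    \<comment> \<open>For \<open>q = 0\<close> the lower limit may be 0, where \<open>y\<close>
      divides by zero; there the factor \<open>q\<close> removes the term. For
      \<open>q \<noteq> 0\<close> the interval stays away from 0.\<close>
    have "continuous_on {?r..1} (\<lambda>u. q * arcsin (y u))"
    proof (cases "q = 0")
      case False
      then have "?r > 0" by (rule quad_root_pos)
      then have "\<bar>y u\<bar> \<le> 1" if "u \<in> {?r..1}" for u
        unfolding y_def using that \<rho> by (intro arcsin_arg_bounds) auto
      moreover have "continuous_on {?r..1} y"
        unfolding y_def using \<open>?r > 0\<close> \<rho> by (intro continuous_intros) auto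
      ultimately show ?thesis by (intro continuous_intros) (auto simp: abs_le_iff)
    qed simp
    moreover have cS: "continuous_on {?r..1} (\<lambda>u. sqrt (quad t q u))"
      unfolding quad_def by (intro continuous_intros)
    moreover have "continuous_on {?r..1} (\<lambda>u. ln (2 * u - t + 2 * sqrt (quad t q u)))"
    proof (rule continuous_on_ln)
      show "continuous_on {?r..1} (\<lambda>u. 2 * u - t + 2 * sqrt (quad t q u))"
        by (intro continuous_on_add continuous_on_mult continuous_on_diff continuous_on_const
            continuous_on_id cS)
      show "\<forall>u\<in>{?r..1}. 2 * u - t + 2 * sqrt (quad t q u) \<noteq> 0"
        using lnpos by (metis atLeastAtMost_iff less_irrefl)
    qed
    moreover have "continuous_on {?r..1} (\<lambda>u. sqrt_coeff t ?Q u)"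
      unfolding sqrt_coeff_def by (intro continuous_intros) auto
    ultimately show "continuous_on {?r..1} \<Phi>"
      unfolding \<Phi>_def by - (assumption | rule continuous_on_add continuous_on_mult
          continuous_on_const)+
    fix u assume "u \<in> {?r<..<1}"
    then have u: "?r < u" "u > 0" using r by auto
    define S where "S = sqrt (quad t q u)"
    have S: "S > 0" "S^2 = quad t q u" using quad_pos[OF \<rho> u(1)] by (auto simp: S_def)
    have dS: "((\<lambda>u. sqrt (quad t q u)) has_real_derivative (2 * u - t) / (2 * S)) (at u)"
      using S unfolding S_def quad_def by (auto intro!: derivative_eq_intros simp: field_simps)
    have "((\<lambda>u. 2 * u - t + 2 * sqrt (quad t q u)) has_real_derivative 2 + (2 * u - t) / S) (at u)"
      by (rule DERIV_cong, (rule dS DERIV_add DERIV_diff DERIV_mult DERIV_const DERIV_ident)+)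
         (use S in \<open>simp add: field_simps\<close>)
    from DERIV_chain2[OF DERIV_ln[OF lnpos[of u]] this] u S(1)
    have dln: "((\<lambda>u. ln (2 * u - t + 2 * sqrt (quad t q u))) has_real_derivative 1 / S) (at u)"
      using lnpos[of u] by (simp add: S_def[symmetric] field_simps)
    have das: "((\<lambda>u. q * arcsin (y u)) has_real_derivative (- (q^2) / (u * S))) (at u)"
    proof (cases "q = 0")
      case False
      with q have q: "q > 0" by simp
      have "1 - (y u)^2 = (2 * q * S / (u * ?\<rho>))^2"
        unfolding y_def arcsin_arg[OF u(2) \<rho>] S(2)[symmetric] by (simp add: power_divide
            power_mult_distrib)
      then have sq: "sqrt (1 - (y u)^2) = 2 * q * S / (u * ?\<rho>)" using q u \<rho> S by simp
      moreover have "2 * q * S / (u * ?\<rho>) > 0" using q u \<rho> S by simp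
      ultimately have "1 - (y u)^2 > 0" by (metis real_sqrt_gt_0_iff)
      then have y1: "-1 < y u" "y u < 1" by (auto simp: abs_square_less_1 abs_less_iff)
      have dy: "(y has_real_derivative (- (2 * q^2) / (u^2 * ?\<rho>))) (at u)"
        unfolding y_def using u \<rho> by (auto intro!: derivative_eq_intros simp: field_simps
            power2_eq_square)
      have "q * (inverse (sqrt (1 - (y u)^2)) * (- (2 * q^2) / (u^2 * ?\<rho>))) = - (q^2) / (u * S)"
        unfolding sq using q u \<rho> S(1) by (simp add: field_simps power2_eq_square)
      with DERIV_cmult[OF DERIV_chain2[OF DERIV_arcsin[OF y1] dy], of q] show ?thesis by (rule DERIV_cong)
    qed simp
    define p' where "p' = (- 1/4 + ?Q/128 + t/96 + 5/1536 * t^2) + 2 * (- 1/24 + t/384) * u - 3 * u^2/64"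
    have dp: "((\<lambda>u. sqrt_coeff t ?Q u) has_real_derivative p') (at u)"
      unfolding sqrt_coeff_def p'_def by (auto intro!: derivative_eq_intros)
    have "(\<Phi> has_real_derivative (p' * S + (2 * u - t) / (2 * S) * sqrt_coeff t ?Q u
        + log_coeff t ?Q * (1 / S) + (- (q^2) / (u * S)))) (at u)"
      unfolding \<Phi>_def S_def using DERIV_mult[OF dp dS]
      by (intro DERIV_add DERIV_cmult dln[unfolded S_def] das[unfolded S_def]) (simp add: S_def)
    \<comment> \<open>Multiplying the differentiated formula by \<open>u * S\<close> and using
      \<open>S^2 = quad t q u\<close> removes the square root and leaves a polynomial
      identity.\<close>
    moreover have "u * p' * quad t q u + u * (2 * u - t) / 2 * sqrt_coeff t ?Q u + log_coeff t ?Q * u - ?Q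
        = sqrt_taylor u * quad t q u"
      unfolding p'_def quad_def sqrt_coeff_def log_coeff_def sqrt_taylor_def
      by (simp add: eval_nat_numeral field_simps)
    then have "p' * S + (2 * u - t) / (2 * S) * sqrt_coeff t ?Q u
        + log_coeff t ?Q * (1 / S) + (- (q^2) / (u * S)) = sqrt_taylor u * S / u"
      unfolding S(2)[symmetric] using S(1) u by (simp add: field_simps power2_eq_square)
    ultimately have "(\<Phi> has_real_derivative sqrt_taylor u * sqrt (quad t q u) / u) (at u)"
      by (simp only: S_def)
    then show "(\<Phi> has_vector_derivative sqrt_taylor u * sqrt (quad t q u) / u) (at u)"
      by (simp add: has_real_derivative_iff_has_vector_derivative)
  qed (use r in auto)
  moreover have "\<Phi> ?r = log_coeff t ?Q * ln ?\<rho> + q * pi/2"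
  proof -
    \<comment> \<open>At the root the arcsine is \<open>pi / 2\<close>, so the difference of the
      endpoint values turns it into an arccosine.\<close>
    have "y ?r = 1" if "q \<noteq> 0"
    proof -
      have "t * ?r + 2 * q^2 = ?r * ?\<rho>"
        using quad_disc_sq[of t q] by (simp add: quad_root_def field_simps power2_eq_square)
      then show ?thesis using quad_root_pos[OF that, of t] \<rho> by (simp add: y_def)
    qed
    moreover have "quad t q ?r = 0" by (simp add: quad_factor)
    moreover have "2 * ?r - t = ?\<rho>" by (simp add: quad_root_def field_simps)
    ultimately show ?thesis by (cases "q = 0") (auto simp: \<Phi>_def)
  qed
  moreover have "\<bar>y 1\<bar> \<le> 1"
    unfolding y_def using r \<rho> by (intro arcsin_arg_bounds) auto
  then have as: "arcsin (y 1) = pi/2 - arccos (y 1)"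
    by (intro arcsin_arccos_eq) auto
  have y1: "y 1 = (t + 2 * q^2) / ?\<rho>" by (simp add: y_def)
  have q1: "quad t q 1 = 1 - t - q^2" by (simp add: quad_def)
  have "\<Phi> 1 = sqrt_coeff t ?Q 1 * sqrt (1 - t - q^2)
     + log_coeff t ?Q * ln (2 - t + 2 * sqrt (1 - t - q^2)) + q * (pi/2 - arccos ((t + 2 * q^2) / ?\<rho>))"
    by (simp add: \<Phi>_def as q1 flip: y1)
  ultimately have "\<Phi> 1 - \<Phi> ?r = sqrt_coeff t ?Q 1 * sqrt (1 - t - q^2)
     + log_coeff t ?Q * (ln (2 - t + 2 * sqrt (1 - t - q^2)) - ln ?\<rho>)
     - q * arccos ((t + 2 * q^2) / ?\<rho>)"
    by (simp add: algebra_simps)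
  with \<open>(_ has_integral (\<Phi> 1 - \<Phi> ?r)) _\<close> show ?thesis by simp
qed

section \<open>Expansion of the elliptic integral\<close>

text \<open>The coefficients of the cubic expansion of \<open>sqrt (1 - t / u - Q / u^2)\<close>
  paired with the four moments of the Taylor remainder.\<close>

definition moment_part :: "real \<Rightarrow> real \<Rightarrow> real" where
  "moment_part t Q = - 5/192 - t/2 * (2 * ln 2 - 17/12) - (Q/2 + t^2/8) * (21/32 - ln 2)
     - (t * Q/4 + t^3/16) * (1/8 - ln 2 / 4)"

text \<open>For \<open>u\<close> above the root, \<open>q^2 / u\<close> is at most minus the smaller
  root of the quadratic, hence at most \<open>2 * R\<close>, although \<open>q^2 / u^2\<close> need
  not be small. So \<open>x = (t + w) / u\<close> satisfies \<open>u^4 * x^4 = (t + w)^4\<close>,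
  which has order four uniformly in \<open>u\<close>.\<close>

lemma quad_expansion_error:
  fixes t q u R :: real
  assumes R: "\<bar>t\<bar> \<le> R" "0 \<le> q" "q \<le> R" and u: "quad_root t q \<le> u" "0 < u" "u
      \<le> 1"
  shows "\<bar>(sqrt (1 - u) - sqrt_taylor u) * (sqrt (quad t q u) / u
      - (1 - t/2/u - (q^2/2 + t^2/8)/u^2 - (t * q^2/4 + t^3/16)/u^3))\<bar> \<le> 100 * R^4"
proof -
  define w x where "w = q^2 / u" and "x = (t + w) / u"
  \<comment> \<open>\<open>E / u^4\<close> is the part of \<open>sqrt_taylor x\<close> of degree at
    least four in \<open>(t, q)\<close>; the surplus powers of \<open>1 / u\<close> are hidden in
    \<open>w\<close>.\<close>
  define E where "E = - (q^4/8) - (3 * t^2 * q^2 + 3 * t * q^2 * w + q^2 * w^2) / 16"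
  have R0: "R \<ge> 0" using R by simp
  have q2: "q^2 \<le> R^2" using R by (intro power_mono)
  have q2': "q^2 = quad_root t q * (quad_root t q - t)"
    using quad_factor[of t q "quad_root t q"] by (simp add: quad_def power2_eq_square algebra_simps)
  have "quad_root t q - t \<ge> 0" using quad_disc_ge[of t q] by (simp add: quad_root_def field_simps)
  then have "q^2 \<le> u * (quad_root t q - t)" unfolding q2' using u by (intro mult_right_mono)
  also have "\<dots> \<le> u * (2 * R)"
    using quad_disc_le[of q t] R u by (intro mult_left_mono) (auto simp: quad_root_def field_simps)
  finally have w: "0 \<le> w" "w \<le> 2 * R" using u by (auto simp: w_def field_simps)
  have x: "sqrt (quad t q u) / u = sqrt (1 - x)" "x \<le> 1"
  proof -
    have e: "quad t q u = u^2 * (1 - x)" using u by (simp add: quad_def x_def w_def field_simps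
        power2_eq_square)
    then show "sqrt (quad t q u) / u = sqrt (1 - x)" using u by (simp add: real_sqrt_mult)
    show "x \<le> 1" using quad_nonneg[OF u(1)] u unfolding e by (simp add: zero_le_mult_iff)
  qed
  have E: "sqrt_taylor x - (1 - t/2/u - (q^2/2 + t^2/8)/u^2 - (t * q^2/4 + t^3/16)/u^3) = E / u^4"
    using u unfolding sqrt_taylor_def x_def w_def E_def
    by (simp add: eval_nat_numeral field_simps)
  have "\<bar>sqrt (1 - x) - (1 - t/2/u - (q^2/2 + t^2/8)/u^2 - (t * q^2/4 + t^3/16)/u^3)\<bar>
      = \<bar>(sqrt (1 - x) - sqrt_taylor x) + E / u^4\<bar>"
    unfolding E[symmetric] by simp
  also have "\<dots> \<le> \<bar>sqrt (1 - x) - sqrt_taylor x\<bar>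
      + \<bar>E / u^4\<bar>" by (rule abs_triangle_ineq)
  also have "\<dots> \<le> x^4 + \<bar>E\<bar> / u^4" using sqrt_taylor_error[OF x(2)] by simp
  finally have "\<bar>sqrt (1 - x) - (1 - t/2/u - (q^2/2 + t^2/8)/u^2 - (t * q^2/4
      + t^3/16)/u^3)\<bar> \<le> x^4 + \<bar>E\<bar> / u^4" .
  then have "\<bar>(sqrt (1 - u) - sqrt_taylor u) * (sqrt (quad t q u) / u
      - (1 - t/2/u - (q^2/2 + t^2/8)/u^2 - (t * q^2/4 + t^3/16)/u^3))\<bar> \<le> u^4 * (x^4
          + \<bar>E\<bar> / u^4)"
    unfolding abs_mult x(1) using sqrt_taylor_error_unit[of u] u
    by (intro mult_mono) auto
  also have "\<dots> = (t + w)^4 + \<bar>E\<bar>"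
    using u by (simp add: x_def field_simps)
  also have "(t + w)^4 \<le> (3 * R)^4"
    using power_mono[of "\<bar>t + w\<bar>" "3 * R" 4] R w by simp
  also have "\<bar>E\<bar> \<le> 2 * R^4"
  proof -
    have "\<bar>E\<bar> \<le> q^2 * q^2/8 + (3 * \<bar>t\<bar>^2 * q^2 + 3 * \<bar>t\<bar> * q^2 * w
        + q^2 * w^2) / 16"
    proof -
      have "\<bar>- a - b - c - d\<bar> \<le> \<bar>a\<bar> + \<bar>b\<bar> + \<bar>c\<bar>
          + \<bar>d\<bar>" for a b c d :: real by linarith
      from this[of "q^2 * q^2/8" "3 * t^2 * q^2/16" "3 * t * q^2 * w/16" "q^2 * w^2/16"] w(1) R(2)
      show ?thesis unfolding E_def by (simp add: abs_mult eval_nat_numeral field_simps)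
    qed
    also have "\<dots> \<le> R^2 * R^2/8 + (3 * R^2 * R^2 + 3 * R * R^2 * (2 * R) + R^2 * (2 * R)^2) / 16"
      using q2 w R R0 by (intro add_mono divide_right_mono mult_mono power_mono) auto
    also have "\<dots> \<le> 2 * R^4" using R0 by (simp add: eval_nat_numeral)
    finally show ?thesis .
  qed
  also have "(3 * R)^4 + 2 * R^4 \<le> 100 * R^4" by (simp add: power_mult_distrib)
  finally show ?thesis by simp
qed

text \<open>Below the root \<open>u \<le> 2 * R\<close>, so after multiplication by
  \<open>u^4\<close> every term of the series has order four in \<open>R\<close>. This permits
  integrating the series over all of \<open>{0..1}\<close>, where its moments are fixed
  numbers.\<close>

lemma quad_series_bound:
  fixes t q u R :: real
  assumes R: "\<bar>t\<bar> \<le> R" "0 \<le> q" "q \<le> R" "R \<le> 1/4" and u: "u \<le> quad_root t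
      q" "0 < u"
  shows "\<bar>(sqrt (1 - u) - sqrt_taylor u)
      * (1 - t/2/u - (q^2/2 + t^2/8)/u^2 - (t * q^2/4 + t^3/16)/u^3)\<bar> \<le> 100 * R^4"
proof -
  have R0: "R \<ge> 0" using R by simp
  have uR: "u \<le> 2 * R" using quad_disc_le[of q t] R u by (auto simp: quad_root_def)
  let ?S = "1 - t/2/u - (q^2/2 + t^2/8)/u^2 - (t * q^2/4 + t^3/16)/u^3"
  have "\<bar>(sqrt (1 - u) - sqrt_taylor u) * ?S\<bar> \<le> u^4 * \<bar>?S\<bar>"
    unfolding abs_mult using sqrt_taylor_error_unit[of u] u uR R by (intro mult_right_mono) auto
  also have "\<dots> = \<bar>u^4 - t/2 * u^3 - (q^2/2 + t^2/8) * u^2 - (t * q^2/4 + t^3/16) * u\<bar>"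
  proof -
    have "u^4 * ?S = u^4 - t/2 * u^3 - (q^2/2 + t^2/8) * u^2 - (t * q^2/4 + t^3/16) * u"
      using u by (simp add: eval_nat_numeral field_simps)
    then show ?thesis using u by (simp flip: abs_mult add: abs_mult_pos')
  qed
  also have "\<dots> \<le> u^4 + \<bar>t\<bar>/2 * u^3 + (q^2/2 + \<bar>t\<bar>^2/8) * u^2
      + (\<bar>t\<bar> * q^2/4 + \<bar>t\<bar>^3/16) * u"
  proof -
    have eq: "\<bar>t/2 * u^3\<bar> = \<bar>t\<bar>/2 * u^3"
      "\<bar>(q^2/2 + t^2/8) * u^2\<bar> = (q^2/2 + \<bar>t\<bar>^2/8) * u^2"
      "\<bar>u^4\<bar> = u^4" "\<bar>(t * q^2/4 + t^3/16) * u\<bar> = \<bar>t * q^2/4 + t^3/16\<bar> * u"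
      using u by (auto simp: abs_mult)
    have le: "\<bar>t * q^2/4 + t^3/16\<bar> * u \<le> (\<bar>t\<bar> * q^2/4 + \<bar>t\<bar>^3/16) * u"
      using u by (intro mult_right_mono order_trans[OF abs_triangle_ineq]) (auto simp: abs_mult power_abs)
    have "\<bar>a - b - c - d\<bar> \<le> \<bar>a\<bar> + \<bar>b\<bar> + \<bar>c\<bar> + \<bar>d\<bar>" for a b c d :: real by linarith
    from this[of "u^4" "t/2 * u^3" "(q^2/2 + t^2/8) * u^2" "(t * q^2/4 + t^3/16) * u"]
    show ?thesis unfolding eq by (rule order_trans[OF _ add_left_mono[OF le]])
  qed
  also have "\<dots> \<le> (2 * R)^4 + R/2 * (2 * R)^3 + (R^2/2 + R^2/8) * (2 * R)^2 + (R * R^2/4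
      + R^3/16) * (2 * R)"
    using R R0 u uR by (intro add_mono mult_mono power_mono divide_right_mono add_nonneg_nonneg
        mult_nonneg_nonneg) auto
  also have "\<dots> \<le> 100 * R^4" using R0 by (simp add: eval_nat_numeral algebra_simps)
  finally show ?thesis .
qed

lemma elliptic_integral_expansion:
  fixes t q R :: real
  assumes R: "\<bar>t\<bar> \<le> R" "0 \<le> q" "q \<le> R" "R \<le> 1/4" and \<rho>: "quad_disc t q > 0"
  shows "(\<lambda>u. sqrt (1 - u) * sqrt (quad t q u) / u) integrable_on {quad_root t q..1}"
    and "\<bar>elliptic_integral t q -
    (sqrt_coeff t (q^2) 1 * sqrt (1 - t - q^2)
     + log_coeff t (q^2) * (ln (2 - t + 2 * sqrt (1 - t - q^2)) - ln (quad_disc t q))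
     - q * arccos ((t + 2 * q^2) / quad_disc t q) + moment_part t (q^2))\<bar> \<le> 100 * R^4"
proof -
  let ?r = "quad_root t q"
  define g where "g = (\<lambda>u. sqrt (1 - u) - sqrt_taylor u)"
  define S where "S = (\<lambda>u. 1 - t/2/u - (q^2/2 + t^2/8)/u^2 - (t * q^2/4 + t^3/16)/u^3)"
  define K where "K = (\<lambda>u. g u * S u)"
  have "q^2 \<le> R^2" using R by (intro power_mono)
  also have "R^2 \<le> (1/4)^2" using R by (intro power_mono) auto
  finally have tq: "t + q^2 < 1" using R by (simp add: power2_eq_square)
  have r: "0 \<le> ?r" "?r < 1" using quad_root_nonneg quad_root_less_one[OF tq] by auto
  have K: "(K has_integral moment_part t (q^2)) {0..1}"
  proof -
    have "((\<lambda>u. g u - t/2 * (g u / u) - (q^2/2 + t^2/8) * (g u / u^2) - (t * q^2/4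
        + t^3/16) * (g u / u^3))
        has_integral moment_part t (q^2)) {0..1}"
      unfolding moment_part_def g_def
      by (intro has_integral_diff has_integral_mult_right sqrt_taylor_moments)
    moreover have "K = (\<lambda>u. g u - t/2 * (g u / u) - (q^2/2 + t^2/8) * (g u / u^2)
        - (t * q^2/4 + t^3/16) * (g u / u^3))"
    proof
      show "K u = g u - t/2 * (g u / u) - (q^2/2 + t^2/8) * (g u / u^2) - (t * q^2/4
          + t^3/16) * (g u / u^3)" for u
        unfolding K_def S_def by (cases "u = 0") (simp_all add: field_simps)
    qed
    ultimately show ?thesis by simp
  qed
  define f where "f = (\<lambda>u. g u * (sqrt (quad t q u) / u))"
  have f: "f integrable_on {?r..1}"
  proof -
    \<comment> \<open>The lower limit may be 0, so \<open>g u / u\<close> is replaced by a form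
      without a singularity: one factor of \<open>(1 - s)^4\<close> cancels against
      \<open>u = (1 - s) * (1 + s)\<close>.\<close>
    have "continuous_on {?r..1} (\<lambda>u. - ((1 - sqrt (1 - u))^3 * ((sqrt (1 - u))^2
        + 4 * sqrt (1 - u) + 5) / (16 * (1 + sqrt (1 - u)))) * sqrt (quad t q u))"
    proof -
      have "16 * (1 + sqrt (1 - u)) \<noteq> 0" if "u \<in> {?r..1}" for u
        using that real_sqrt_ge_zero[of "1 - u"] by fastforce
      then show ?thesis unfolding quad_def by (intro continuous_intros) auto
    qed
    then show ?thesis
    proof (rule integrable_eq[OF integrable_continuous_real])
      fix u assume "u \<in> {?r..1}"
      then have u: "0 \<le> u" "u \<le> 1" using r by auto
      define s where "s = sqrt (1 - u)"
      have s: "s \<ge> 0" "u = (1 - s) * (1 + s)" using u by (auto simp: s_def algebra_simps)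
      have rem: "g u = - ((1 - s)^4 * (s^2 + 4 * s + 5) / 16)"
        unfolding g_def s_def by (rule sqrt_taylor_remainder[OF u(2)])
      have "- ((1 - s)^3 * (s^2 + 4 * s + 5) / (16 * (1 + s)))
          = - ((1 - s)^4 * (s^2 + 4 * s + 5) / 16) / ((1 - s) * (1 + s))"
        using s(1) by (cases "s = 1") (auto simp: eval_nat_numeral divide_simps)
      also have "\<dots> = g u / u" by (simp only: rem s(2)[symmetric])
      finally have "- ((1 - s)^3 * (s^2 + 4 * s + 5) / (16 * (1 + s))) = g u / u" .
      then show "- ((1 - sqrt (1 - u))^3 * ((sqrt (1 - u))^2 + 4 * sqrt (1 - u) + 5) / (16 * (1
          + sqrt (1 - u)))) * sqrt (quad t q u) = f u"
        unfolding f_def s_def[symmetric] by simp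
    qed
  qed
  have K1: "K integrable_on {?r..1}" "K integrable_on {0..?r}"
    using K r by (auto intro: integrable_on_subinterval)
  have 1: "\<bar>integral {?r..1} (\<lambda>u. f u - K u)\<bar> \<le> 100 * R^4 * (1 - ?r)"
  proof -
    have "norm (integral {?r..1} (\<lambda>u. f u - K u)) \<le> 100 * R^4 * measure lborel {?r..1}"
    proof (rule has_integral_bound_real[where S = "{0}"])
      show "((\<lambda>u. f u - K u) has_integral integral {?r..1} (\<lambda>u. f u - K u)) {?r..1}"
        using f K1 by (intro integrable_integral integrable_diff)
      fix u assume "u \<in> {?r..1} - {0}"
      then have u: "?r \<le> u" "0 < u" "u \<le> 1" using r by auto
      show "norm (f u - K u) \<le> 100 * R^4"
      proof -
        have "f u - K u = g u * (sqrt (quad t q u) / u - S u)" by (simp add: f_def K_def algebra_simps)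
        with quad_expansion_error[OF R(1-3) u] show ?thesis by (simp add: g_def S_def)
      qed
    qed (use R in auto)
    then show ?thesis using r by simp
  qed
  have 2: "\<bar>integral {0..?r} K\<bar> \<le> 100 * R^4 * ?r"
  proof -
    have "norm (integral {0..?r} K) \<le> 100 * R^4 * measure lborel {0..?r}"
    proof (rule has_integral_bound_real[where S = "{0}"])
      show "(K has_integral integral {0..?r} K) {0..?r}"
        using K1 by (intro integrable_integral)
      fix u assume "u \<in> {0..?r} - {0}"
      then show "norm (K u) \<le> 100 * R^4"
        using quad_series_bound[OF R, of u] by (auto simp: K_def g_def S_def)
    qed (use R in auto)
    then show ?thesis using r by simp
  qed
  have 3: "integral {0..?r} K + integral {?r..1} K = moment_part t (q^2)"
    using Henstock_Kurzweil_Integration.integral_combine[of 0 ?r 1 K] K r by (auto simp: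
        has_integral_integrable integral_unique)
  define T where "T = sqrt_coeff t (q^2) 1 * sqrt (1 - t - q^2)
     + log_coeff t (q^2) * (ln (2 - t + 2 * sqrt (1 - t - q^2)) - ln (quad_disc t q))
     - q * arccos ((t + 2 * q^2) / quad_disc t q)"
  have "((\<lambda>u. sqrt_taylor u * sqrt (quad t q u) / u + f u) has_integral T
      + integral {?r..1} f) {?r..1}"
    unfolding T_def by (intro has_integral_add has_integral_sqrt_taylor_quad R tq \<rho>
        integrable_integral f)
  moreover have "(\<lambda>u. sqrt_taylor u * sqrt (quad t q u) / u + f u) = (\<lambda>u. sqrt (1
      - u) * sqrt (quad t q u) / u)"
    unfolding f_def g_def by (simp add: field_simps flip: add_divide_distrib diff_divide_distrib)
  ultimately have E: "((\<lambda>u. sqrt (1 - u) * sqrt (quad t q u) / u) has_integral T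
      + integral {?r..1} f) {?r..1}"
    by simp
  then show "(\<lambda>u. sqrt (1 - u) * sqrt (quad t q u) / u) integrable_on {?r..1}"
    by (rule has_integral_integrable)
  from E have "elliptic_integral t q = T + integral {?r..1} f"
    unfolding elliptic_integral_def by (rule integral_unique)
  moreover have "integral {?r..1} (\<lambda>u. f u - K u) = integral {?r..1} f - integral {?r..1} K"
    using f K1 by (intro Henstock_Kurzweil_Integration.integral_diff)
  ultimately have "elliptic_integral t q - (T + moment_part t (q^2))
      = integral {?r..1} (\<lambda>u. f u - K u) - integral {0..?r} K"
    using 3 by simp
  also have "\<bar>\<dots>\<bar> \<le> 100 * R^4 * (1 - ?r) + 100 * R^4 * ?r"
    using 1 2 by linarith
  also have "\<dots> = 100 * R^4" by (simp add: algebra_simps)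
  finally show "\<bar>elliptic_integral t q -
    (sqrt_coeff t (q^2) 1 * sqrt (1 - t - q^2)
     + log_coeff t (q^2) * (ln (2 - t + 2 * sqrt (1 - t - q^2)) - ln (quad_disc t q))
     - q * arccos ((t + 2 * q^2) / quad_disc t q) + moment_part t (q^2))\<bar> \<le> 100 * R^4"
    unfolding T_def .
qed

section \<open>Reduction of the action\<close>

text \<open>The energy shown is the one for which \<open>1 / m^2\<close> is a root of the cubic,
  whence the factor \<open>1 - u\<close>.\<close>

lemma Pcub_rescale:
  assumes "m > 0"
  shows "Pcub ((1 - m^2)/m^4 + b^2*m^2/4) b (u / m^2) = 2 / m^6 * ((1 - u) * quad (m^2 - 1) (b*m^3/2) u)"
  unfolding Pcub_def quad_def using assms by (simp add: eval_nat_numeral field_simps)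

lemma Pcub_roots:
  assumes m: "m > 0" and h: "h = (1 - m^2)/m^4 + b^2*m^2/4"
    and tq: "m^2 - 1 + (b*m^3/2)^2 < 1"
  shows "zroot3 h b = 1 / m^2" "zroot2 h b = quad_root (m^2 - 1) (b*m^3/2) / m^2"
proof -
  let ?t = "m^2 - 1" and ?q = "b*m^3/2"
  let ?r = "quad_root ?t ?q" and ?r' = "(?t - quad_disc ?t ?q) / 2"
  have r: "?r < 1" "?r' \<le> ?r"
    using quad_root_less_one[OF tq] quad_disc_ge[of ?t ?q] by (auto simp: quad_root_def)
  have iff: "Pcub h b z = 0 \<longleftrightarrow> m^2 * z = 1 \<or> m^2 * z = ?r \<or> m^2 * z = ?r'" for z
  proof -
    have "Pcub h b z = 2 / m^6 * ((1 - m^2 * z) * quad ?t ?q (m^2 * z))"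
      using Pcub_rescale[OF m, of b "m^2 * z"] m h by simp
    moreover have "quad ?t ?q (m^2 * z) = (m^2 * z - ?r) * (m^2 * z - ?r')"
      unfolding quad_factor by (simp add: diff_divide_distrib)
    ultimately have "Pcub h b z = 2 / m^6 * ((1 - m^2 * z) * ((m^2 * z - ?r) * (m^2 * z - ?r')))"
      by simp
    then show ?thesis using m by simp
  qed
  have scale: "m^2 * z = c \<longleftrightarrow> z = c / m^2" for z c
    using m by (simp add: eq_divide_eq mult.commute)
  have roots: "{z. Pcub h b z = 0} = {1 / m^2, ?r / m^2, ?r' / m^2}" unfolding iff scale by auto
  have "?r / m^2 < 1 / m^2" using r m by (intro divide_strict_right_mono) auto
  moreover have "?r' / m^2 \<le> ?r / m^2" using r by (intro divide_right_mono) auto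
  ultimately have le: "?r / m^2 < 1 / m^2" "?r' / m^2 \<le> ?r / m^2" .
  show 3: "zroot3 h b = 1 / m^2"
    unfolding zroot3_def roots using le by (intro Max_eqI) auto
  have "{z. Pcub h b z = 0} - {zroot3 h b} = {?r / m^2, ?r' / m^2}"
    unfolding 3 roots using le by auto
  then show "zroot2 h b = ?r / m^2"
    unfolding zroot2_def using le by (auto intro: Max_eqI)
qed

text \<open>The form \<open>dz / z\<close> is invariant under scaling. The factor
  \<open>2 / m^3\<close> is therefore the \<open>sqrt 2\<close> in the definition of the action
  times the \<open>sqrt 2 / m^3\<close> coming from the square root of the cubic.\<close>

lemma I1_eq_elliptic_integral:
  assumes m: "m > 0" and h: "h = (1 - m^2)/m^4 + b^2*m^2/4"
  defines "t \<equiv> m^2 - 1" and "q \<equiv> b*m^3/2"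
  assumes tq: "t + q^2 < 1"
    and int: "(\<lambda>u. sqrt (1 - u) * sqrt (quad t q u) / u) integrable_on {quad_root t q..1}"
  shows "2 * pi * I1 h b = 2 / m^3 * elliptic_integral t q"
proof -
  let ?F = "\<lambda>u. sqrt (1 - u) * sqrt (quad t q u) / u"
  have "(?F has_integral elliptic_integral t q) (cbox (quad_root t q) 1)"
    unfolding elliptic_integral_def using int by (simp add: integrable_integral)
  from has_integral_affinity'[OF this, of "m^2" 0] m
  have "((\<lambda>z. ?F (m^2 * z)) has_integral elliptic_integral t q / m^2) {quad_root t q / m^2..1 /
      m^2}"
    by (simp add: divide_inverse mult.commute)
  then have "((\<lambda>z. ?F (m^2 * z)) has_integral elliptic_integral t q / m^2) {zroot2 h b..zroot3 h b}"
    using Pcub_roots[OF m h] tq unfolding t_def q_def by simp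
  then have "((\<lambda>z. sqrt 2 / m * ?F (m^2 * z)) has_integral sqrt 2 / m * (elliptic_integral t q
      / m^2)) {zroot2 h b..zroot3 h b}"
    by (rule has_integral_mult_right)
  moreover have "sqrt 2 / m * ?F (m^2 * z) = sqrt (Pcub h b z) / z" for z
  proof -
    have "Pcub h b z = 2 / (m^3)^2 * ((1 - m^2 * z) * quad t q (m^2 * z))"
      using Pcub_rescale[OF m, of b "m^2 * z"] m h by (simp add: t_def q_def)
    then have "sqrt (Pcub h b z) = sqrt 2 / m^3 * (sqrt (1 - m^2 * z) * sqrt (quad t q (m^2 * z)))"
      by (simp only: real_sqrt_mult real_sqrt_divide real_sqrt_abs) (use m in simp)
    then show ?thesis using m by (simp add: eval_nat_numeral)
  qed
  ultimately have "integral {zroot2 h b..zroot3 h b} (\<lambda>z. sqrt (Pcub h b z) / z)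
      = sqrt 2 / m * (elliptic_integral t q / m^2)"
    by (simp add: integral_unique)
  then show ?thesis unfolding I1_def using m by (simp add: eval_nat_numeral field_simps)
qed

text \<open>Near \<open>m = 1\<close> the energy falls with slope about -2, so a displacement of
  \<open>4 * r\<close> to either side passes every \<open>h\<close> with
  \<open>\<bar>h\<bar> \<le> 2 * r\<close>, the \<open>b\<close>-term being quadratically small.
  Only the distance of \<open>m\<close> from 1 is recorded: the later expansions are polynomial in
  \<open>m - 1\<close>.\<close>

lemma energy_parameter_exists:
  fixes h b r :: real
  assumes "\<bar>h\<bar> \<le> 2 * r" "\<bar>b\<bar> \<le> r" "0 < r" "r \<le> 1/100"
  shows "\<exists>m. \<bar>m - 1\<bar> \<le> 4 * r \<and> h = (1 - m^2)/m^4 + b^2*m^2/4"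
proof -
  let ?f = "\<lambda>m. (1 - m^2)/m^4 + b^2*m^2/4"
  have b2: "b^2 \<le> r^2" using power_mono[of "\<bar>b\<bar>" r 2] assms by simp
  have rr: "r^2 \<le> r/100" using assms by (simp add: power2_eq_square)
  have "\<exists>m\<ge>1 - 4 * r. m \<le> 1 + 4 * r \<and> ?f m = h"
  proof (rule IVT2)
    have p: "(1 + 4 * r)^4 \<le> 2"
    proof -
      have "(1 + 4 * r)^4 \<le> (1 + 4 * (1/100))^4" using assms by (intro power_mono) auto
      also have "\<dots> \<le> 2" by (simp add: eval_nat_numeral)
      finally show ?thesis .
    qed
    have "(1 - (1 + 4 * r)^2)/(1 + 4 * r)^4 \<le> (- (8 * r)) / 2"
    proof -
      have "(1 - (1 + 4 * r)^2)/(1 + 4 * r)^4 \<le> (- (8 * r)) / (1 + 4 * r)^4"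
        using assms by (intro divide_right_mono) (auto simp: power2_eq_square algebra_simps)
      also have "\<dots> \<le> (- (8 * r)) / 2" using p assms by (intro divide_left_mono_neg) auto
      finally show ?thesis .
    qed
    moreover have "b^2 * (1 + 4 * r)^2/4 \<le> r^2 * 2^2/4"
      using assms by (intro divide_right_mono mult_mono b2 power_mono) auto
    ultimately show "?f (1 + 4 * r) \<le> h" using assms rr by auto
    have "(1 - (1 - 4 * r)^2)/1 \<le> (1 - (1 - 4 * r)^2)/(1 - 4 * r)^4"
      using assms by (intro divide_left_mono) (auto simp: power_le_one abs_square_le_1)
    moreover have "h \<le> 1 - (1 - 4 * r)^2"
    proof -
      have "h + 16 * r^2 \<le> 8 * r" using rr assms(1,3) by linarith
      then show ?thesis by (simp add: power2_eq_square algebra_simps)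
    qed
    moreover have "b^2 * (1 - 4 * r)^2/4 \<ge> 0" by (intro divide_nonneg_pos mult_nonneg_nonneg) auto
    ultimately show "h \<le> ?f (1 - 4 * r)" unfolding div_by_1 by (meson add_increasing2 order_trans)
    show "\<forall>x. 1 - 4 * r \<le> x \<and> x \<le> 1 + 4 * r \<longrightarrow> isCont ?f x"
    proof (intro allI impI)
      fix x assume "1 - 4 * r \<le> x \<and> x \<le> 1 + 4 * r"
      then have "x > 0" using assms(4) by linarith
      then have "x^4 \<noteq> 0" by simp
      then show "isCont ?f x"
        by (intro isCont_add isCont_divide isCont_diff isCont_mult isCont_power continuous_const
            continuous_ident) auto
    qed
  qed (use assms in auto)
  then obtain m where "1 - 4 * r \<le> m" "m \<le> 1 + 4 * r" "?f m = h" by blast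
  then show ?thesis by (intro exI[of _ m]) auto
qed

section \<open>Orders of vanishing\<close>

lemma norm_Ln_quadratic:
  fixes z :: complex
  assumes "norm z \<le> 1/2"
  shows "norm (Ln (1 + z) - (z - z^2/2)) \<le> 2 * norm z ^ 3"
proof -
  have z: "norm z < 1" using assms by simp
  have "(\<lambda>n. - ((-z)^(n + 3)) / of_nat (n + 3)) sums (Ln (1 + z) - (\<Sum>n<3.
      - ((-z)^n) / of_nat n))"
    using sums_split_initial_segment[OF Ln_series'[OF z], of 3] by simp
  \<comment> \<open>The term for \<open>n = 0\<close> is a division by zero and hence 0.\<close>
  moreover have "(\<Sum>n<3. - ((-z)^n) / of_nat n) = z - z^2/2"
    by (simp add: eval_nat_numeral)
  ultimately have s: "(\<lambda>n. - ((-z)^(n + 3)) / of_nat (n + 3)) sums (Ln (1 + z) - (z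
      - z^2/2))" by simp
  have "norm (\<Sum>n. - ((-z)^(n + 3)) / of_nat (n + 3)) \<le> (\<Sum>n. norm z ^ 3 * norm z ^ n)"
  proof (rule norm_suminf_le)
    fix n
    have "norm (- ((-z)^(n + 3)) / of_nat (n + 3)) = norm z ^ (n + 3) / real (n + 3)"
      by (simp only: norm_divide norm_minus_cancel norm_power norm_of_nat)
    also have "\<dots> \<le> norm z ^ (n + 3) / 1" by (intro divide_left_mono) auto
    finally show "norm (- ((-z)^(n + 3)) / of_nat (n + 3)) \<le> norm z ^ 3 * norm z ^ n"
      by (simp add: power_add mult.commute)
  qed (use z in \<open>intro summable_mult summable_geometric, simp\<close>)
  also have "\<dots> = norm z ^ 3 * (1 / (1 - norm z))"
    using z by (subst suminf_mult) (auto simp: summable_geometric suminf_geometric)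
  also have "\<dots> \<le> norm z ^ 3 * 2"
    using assms by (intro mult_left_mono) (auto simp: field_simps)
  finally show ?thesis using s by (simp add: sums_iff mult.commute)
qed

lemma abs_ln_quadratic:
  fixes x :: real
  assumes "\<bar>x\<bar> \<le> 1/2"
  shows "\<bar>ln (1 + x) - (x - x^2/2)\<bar> \<le> 2 * \<bar>x\<bar> ^ 3"
proof -
  have "Ln (1 + of_real x) = of_real (ln (1 + x))"
    using assms by (subst Ln_of_real[symmetric]) auto
  then have "Ln (1 + of_real x) - (of_real x - (of_real x)^2/2) = complex_of_real (ln (1 + x) - (x
      - x^2/2))"
    by simp
  moreover have "norm (Ln (1 + of_real x) - (of_real x - (of_real x)^2/2)) \<le> 2 * norm
      (complex_of_real x) ^ 3"
    using assms by (intro norm_Ln_quadratic) simp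
  ultimately show ?thesis by (simp only: norm_of_real real_norm_def)
qed

section \<open>Calculus of orders with respect to a small positive function\<close>

locale scale =
  fixes F :: "'a filter" and r :: "'a \<Rightarrow> real"
  assumes r: "eventually (\<lambda>p. 0 < r p) F" and r_lim: "(r \<longlongrightarrow> 0) F"
begin

text \<open>Values may be real or complex while the comparison function stays real, so that one
  calculus covers the real expansions and those of the complex logarithm.\<close>

definition of_order :: "nat \<Rightarrow> ('a \<Rightarrow> 'b :: real_normed_field) \<Rightarrow>
    bool" where
  "of_order n f \<longleftrightarrow> (\<exists>C. eventually (\<lambda>p. norm (f p) \<le> C * r p ^ n) F)"

lemma r_less: "c > 0 \<Longrightarrow> eventually (\<lambda>p. 0 < r p \<and> r p < c) F"
  using eventually_conj[OF r order_tendstoD(2)[OF r_lim, of c]] by simp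

lemma of_order_bound:
  assumes "of_order n f"
  obtains C where "C > 0" "eventually (\<lambda>p. norm (f p) \<le> C * r p ^ n) F"
proof -
  from assms obtain C where C: "eventually (\<lambda>p. norm (f p) \<le> C * r p ^ n) F"
    by (auto simp: of_order_def)
  from C r have "eventually (\<lambda>p. norm (f p) \<le> (\<bar>C\<bar> + 1) * r p ^ n) F"
  proof eventually_elim
    case (elim p)
    have "C * r p ^ n \<le> (\<bar>C\<bar> + 1) * r p ^ n" using elim by (intro mult_right_mono) auto
    with elim show ?case by linarith
  qed
  then show ?thesis by (intro that[of "\<bar>C\<bar> + 1"]) auto
qed

lemma of_order_bound2:
  assumes "of_order n f" "of_order m g"
  obtains C where "C > 0" "eventually (\<lambda>p. norm (f p) \<le> C * r p ^ n \<and> norm (g p) \<le>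
      C * r p ^ m) F"
proof -
  obtain C where C: "C > 0" "eventually (\<lambda>p. norm (f p) \<le> C * r p ^ n) F"
    using assms(1) by (rule of_order_bound)
  obtain D where D: "D > 0" "eventually (\<lambda>p. norm (g p) \<le> D * r p ^ m) F"
    using assms(2) by (rule of_order_bound)
  from C(2) D(2) r have "eventually (\<lambda>p. norm (f p) \<le> max C D * r p ^ n \<and> norm (g p)
      \<le> max C D * r p ^ m) F"
  proof eventually_elim
    case (elim p)
    then have "C * r p ^ n \<le> max C D * r p ^ n" "D * r p ^ m \<le> max C D * r p ^ m"
      by (auto intro!: mult_right_mono)
    with elim show ?case by linarith
  qed
  with C(1) show ?thesis by (intro that[of "max C D"]) auto
qed

lemma of_order_le:
  assumes "of_order n g" "eventually (\<lambda>p. norm (f p) \<le> c * norm (g p)) F"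
  shows "of_order n f"
proof -
  obtain C where C: "C > 0" "eventually (\<lambda>p. norm (g p) \<le> C * r p ^ n) F"
    using assms(1) by (rule of_order_bound)
  from C(2) assms(2) r have "eventually (\<lambda>p. norm (f p) \<le> (\<bar>c\<bar> * C) * r p ^ n) F"
  proof eventually_elim
    case (elim p)
    have "norm (f p) \<le> \<bar>c\<bar> * norm (g p)"
      using elim(2) mult_right_mono[OF abs_ge_self[of c] norm_ge_zero[of "g p"]] by linarith
    also have "\<dots> \<le> \<bar>c\<bar> * (C * r p ^ n)" using elim by (intro mult_left_mono) auto
    finally show ?case by simp
  qed
  then show ?thesis by (auto simp: of_order_def)
qed

lemma of_order_cong:
  assumes "of_order n g" "eventually (\<lambda>p. f p = g p) F"
  shows "of_order n f"
  using assms(1) by (rule of_order_le[where c = 1]) (rule eventually_mono[OF assms(2)], simp)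

lemma of_order_const: "of_order 0 (\<lambda>p. c)"
  unfolding of_order_def by (rule exI[of _ "norm c"]) simp

lemma of_order_zero: "of_order n (\<lambda>p. 0)"
  unfolding of_order_def by (rule exI[of _ 0]) simp

lemma of_order_add:
  assumes "of_order n f" "of_order n g"
  shows "of_order n (\<lambda>p. f p + g p)"
proof -
  obtain C where C: "C > 0" "eventually (\<lambda>p. norm (f p) \<le> C * r p ^ n \<and> norm (g p)
      \<le> C * r p ^ n) F"
    using assms by (rule of_order_bound2)
  from C(2) have "eventually (\<lambda>p. norm (f p + g p) \<le> (2 * C) * r p ^ n) F"
  proof eventually_elim
    case (elim p)
    then show ?case using norm_triangle_ineq[of "f p" "g p"] by linarith
  qed
  then show ?thesis by (auto simp: of_order_def)
qed

lemma of_order_minus: "of_order n f \<Longrightarrow> of_order n (\<lambda>p. - f p)"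
  by (simp add: of_order_def)

lemma of_order_diff: "of_order n f \<Longrightarrow> of_order n g \<Longrightarrow> of_order n
    (\<lambda>p. f p - g p)"
  using of_order_add[OF _ of_order_minus, of n f g] by simp

lemma of_order_mult:
  assumes "of_order n f" "of_order m g"
  shows "of_order (n + m) (\<lambda>p. f p * g p)"
proof -
  obtain C where C: "C > 0" "eventually (\<lambda>p. norm (f p) \<le> C * r p ^ n \<and> norm (g p)
      \<le> C * r p ^ m) F"
    using assms by (rule of_order_bound2)
  from C(2) r have "eventually (\<lambda>p. norm (f p * g p) \<le> (C * C) * r p ^ (n + m)) F"
  proof eventually_elim
    case (elim p)
    then have "norm (f p) * norm (g p) \<le> (C * r p ^ n) * (C * r p ^ m)"
      using C(1) by (intro mult_mono) auto
    then show ?case by (simp add: norm_mult power_add mult_ac)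
  qed
  then show ?thesis by (auto simp: of_order_def)
qed

lemma of_order_mono:
  assumes "of_order n f" "m \<le> n"
  shows "of_order m f"
proof -
  obtain C where C: "C > 0" "eventually (\<lambda>p. norm (f p) \<le> C * r p ^ n) F"
    using assms(1) by (rule of_order_bound)
  from C(2) r_less[of 1, simplified] have "eventually (\<lambda>p. norm (f p) \<le> C * r p ^ m) F"
  proof eventually_elim
    case (elim p)
    have "C * r p ^ n \<le> C * r p ^ m"
      using elim C assms(2) by (intro mult_left_mono power_decreasing) auto
    with elim show ?case by linarith
  qed
  then show ?thesis by (auto simp: of_order_def)
qed

lemma of_order_mult': "of_order n f \<Longrightarrow> of_order m g \<Longrightarrow> k \<le> n
    + m \<Longrightarrow> of_order k (\<lambda>p. f p * g p)"
  by (rule of_order_mono[OF of_order_mult])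

lemma of_order_cmult: "of_order n f \<Longrightarrow> of_order n (\<lambda>p. c * f p)"
  using of_order_mult[OF of_order_const[of c], of n f] by simp

lemma of_order_divide_const: "of_order n f \<Longrightarrow> of_order n (\<lambda>p. f p / c)"
  using of_order_cmult[of n f "inverse c"] by (simp add: field_simps)

lemma of_order_power: "of_order n f \<Longrightarrow> of_order (n * k) (\<lambda>p. f p ^ k)"
proof (induction k)
  case 0
  then show ?case using of_order_const[of 1] by simp
next
  case (Suc k)
  then show ?case using of_order_mult[of n f "n * k" "\<lambda>p. f p ^ k"] by (simp add: algebra_simps)
qed

lemma of_order_power': "of_order n f \<Longrightarrow> m \<le> n * k \<Longrightarrow> of_order m
    (\<lambda>p. f p ^ k)"
  by (rule of_order_mono[OF of_order_power])

text \<open>Telescoping as \<open>f * (g - g') + (f - f') * g'\<close>. A factor that is itself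
  small lets the other factor be known to correspondingly lower order.\<close>

lemma of_order_mult_approx:
  assumes "of_order n (\<lambda>p. f p - f' p)" "of_order m (\<lambda>p. g p
      - g' p)" "of_order k f" "of_order l g'"
    and "N \<le> k + m" "N \<le> n + l"
  shows "of_order N (\<lambda>p. f p * g p - f' p * g' p)"
proof -
  have "of_order N (\<lambda>p. f p * (g p - g' p) + (f p - f' p) * g' p)"
    by (intro of_order_add) (rule of_order_mult'[OF assms(3,2,5)], rule of_order_mult'[OF assms(1,4,6)])
  then show ?thesis by (simp add: algebra_simps)
qed

lemma of_order_trans:
  "of_order n (\<lambda>p. f p - g p) \<Longrightarrow> of_order n (\<lambda>p. g p
      - h p) \<Longrightarrow> of_order n (\<lambda>p. f p - h p)"
  using of_order_add[of n "\<lambda>p. f p - g p" "\<lambda>p. g p - h p"] by simp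

lemma of_order_tendsto_0:
  assumes "of_order n f" "0 < n"
  shows "(f \<longlongrightarrow> 0) F"
proof -
  have "of_order 1 f" using assms(2) by (intro of_order_mono[OF assms(1)]) simp
  then obtain C where C: "C > 0" "eventually (\<lambda>p. norm (f p) \<le> C * r p ^ 1) F"
    by (rule of_order_bound)
  have "((\<lambda>p. C * r p ^ 1) \<longlongrightarrow> C * 0 ^ 1) F" by (intro tendsto_intros r_lim)
  then have "((\<lambda>p. C * r p ^ 1) \<longlongrightarrow> 0) F" by simp
  with C(2) show ?thesis by (rule Lim_null_comparison)
qed

lemma of_order_tendsto:
  assumes "(f \<longlongrightarrow> c) F"
  shows "of_order 0 f"
proof -
  have "eventually (\<lambda>p. norm (f p) < norm c + 1) F"
    using tendsto_norm[OF assms] by (rule order_tendstoD) simp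
  then show ?thesis
    unfolding of_order_def by (intro exI[of _ "norm c + 1"]) (rule eventually_mono, assumption, simp)
qed

lemma of_order_abs_le:
  fixes f g :: "'a \<Rightarrow> real"
  assumes "of_order n g" "eventually (\<lambda>p. \<bar>f p\<bar> \<le> c * \<bar>g p\<bar>) F"
  shows "of_order n f"
  using of_order_le[of n g f c] assms by simp

lemma of_order_Complex:
  assumes "of_order n f" "of_order n g"
  shows "of_order n (\<lambda>p. Complex (f p) (g p))"
proof -
  have "of_order n (\<lambda>p. \<bar>f p\<bar> + \<bar>g p\<bar>)"
    using assms by (intro of_order_add) (auto simp: of_order_def)
  then show ?thesis
    by (rule of_order_le[where c = 1], intro always_eventually allI) (simp add: order_trans[OF cmod_le])
qed

lemma of_order_Re: "of_order n f \<Longrightarrow> of_order n (\<lambda>p. Re (f p))"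
  by (rule of_order_le[where c = 1], assumption, intro always_eventually allI) (simp add: abs_Re_le_cmod)

lemma of_order_iff_bigo:
  fixes f :: "'a \<Rightarrow> real"
  shows "of_order n f \<longleftrightarrow> f \<in> O[F](\<lambda>p. r p ^ n)"
proof
  assume "of_order n f"
  then obtain C where C: "C > 0" "eventually (\<lambda>p. norm (f p) \<le> C * r p ^ n) F"
    by (rule of_order_bound)
  from C(2) r have "eventually (\<lambda>p. norm (f p) \<le> C * norm (r p ^ n)) F"
    by eventually_elim simp
  then show "f \<in> O[F](\<lambda>p. r p ^ n)" by (rule bigoI)
next
  assume "f \<in> O[F](\<lambda>p. r p ^ n)"
  then obtain C where C: "C > 0" "eventually (\<lambda>p. norm (f p) \<le> C * norm (r p ^ n)) F"
    by (rule landau_o.bigE)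
  from C(2) r have "eventually (\<lambda>p. norm (f p) \<le> C * r p ^ n) F"
    by eventually_elim simp
  then show "of_order n f" by (auto simp: of_order_def)
qed

end

section \<open>Taylor polynomials\<close>

text \<open>
  With \<open>x = m - 1\<close> and \<open>y = \<bar>j\<^sub>2\<bar>\<close>, the following are truncated Taylor expansions at the origin:
  \<open>action_poly\<close> of \<open>j\<^sub>1\<close>, followed by its powers; \<open>disc_poly\<close> of \<open>q\<^sup>2\<close>; \<open>sqrt_poly\<close> of \<open>sqrt (1 - t - q\<^sup>2)\<close>;
  \<open>log_poly\<close> of \<open>ln (1 + logarg_poly)\<close>; \<open>re_poly\<close> and \<open>im_poly\<close> of the point
  \<open>w = - (t + 2 * q\<^sup>2) + 2 * \<i> * q * sqrt (1 - t - q\<^sup>2)\<close>; \<open>eps\<close> of \<open>(j\<^sub>1 + \<i> * y) / w - 1\<close> and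
  \<open>log\<close> of the logarithm of that quotient; \<open>angle_poly\<close> of the real part of
  \<open>(j\<^sub>1 + \<i> * y) * Ln ((j\<^sub>1 + \<i> * y) / w)\<close>.
\<close>

definition action_poly :: "real \<Rightarrow> real \<Rightarrow> real" where
  "action_poly x y = - 2 * x + 1/8 * y^2 + 11/2 * x^2 + 13/32 * x * y^2 - 79/8 * x^3 + 1/1024 * y^4
      + 65/128 * x^2 * y^2 + 993/64 * x^4"

definition action_poly2 :: "real \<Rightarrow> real \<Rightarrow> real" where
  "action_poly2 x y = 4 * x^2 - 1/2 * x * y^2 - 22 * x^3 + 1/64 * y^4 - 1/4 * x^2 * y^2 + 279/4 * x^4"

definition action_poly3 :: "real \<Rightarrow> real \<Rightarrow> real" where
  "action_poly3 x y = - 8 * x^3 + 3/2 * x^2 * y^2 + 66 * x^4"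

definition action_poly4 :: "real \<Rightarrow> real \<Rightarrow> real" where
  "action_poly4 x y = 16 * x^4"

definition disc_poly :: "real \<Rightarrow> real \<Rightarrow> real" where
  "disc_poly x y = 1/4 * y^2 + 3/2 * x * y^2 + 15/4 * x^2 * y^2"

definition sqrt_poly :: "real \<Rightarrow> real \<Rightarrow> real" where
  "sqrt_poly x y = 1 - x - 1/8 * y^2 - x^2 - 7/8 * x * y^2 - x^3"

definition logarg_poly :: "real \<Rightarrow> real \<Rightarrow> real" where
  "logarg_poly x y = - x - 1/16 * y^2 - 3/4 * x^2"

definition log_poly :: "real \<Rightarrow> real \<Rightarrow> real" where
  "log_poly x y = - x - 1/16 * y^2 - 5/4 * x^2"

definition re_poly :: "real \<Rightarrow> real \<Rightarrow> real" where
  "re_poly x y = - 2 * x - 1/2 * y^2 - x^2 - 3 * x * y^2"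

definition im_poly :: "real \<Rightarrow> real \<Rightarrow> real" where
  "im_poly x y = y + 2 * x * y - 1/8 * y^3 - x^2 * y"

definition re_eps :: "real \<Rightarrow> real \<Rightarrow> real" where
  "re_eps x y = - 13/4 * x - 3/16 * y^2 + 105/16 * x^2"

definition im_eps :: "real \<Rightarrow> real \<Rightarrow> real" where
  "im_eps x y = - 5/8 * y - 5/32 * x * y"

definition re_log :: "real \<Rightarrow> real \<Rightarrow> real" where
  "re_log x y = - 13/4 * x + 1/128 * y^2 + 41/32 * x^2"

definition im_log :: "real \<Rightarrow> real \<Rightarrow> real" where
  "im_log x y = - 5/8 * y - 35/16 * x * y"

definition angle_poly :: "real \<Rightarrow> real \<Rightarrow> real" where
  "angle_poly x y = 5/8 * y^2 + 13/2 * x^2 + 113/64 * x * y^2 - 327/16 * x^3"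

definition coeff_poly :: "real \<Rightarrow> real \<Rightarrow> real" where
  "coeff_poly x y = 133/192 + 53/192 * x + 19/1536 * y^2 + 41/192 * x^2 + 127/1536 * x * y^2 + 11/96 * x^3"

definition moment_poly :: "real \<Rightarrow> real \<Rightarrow> real" where
  "moment_poly x y = - 5/192 + (17/12 + (- 2) * ln 2) * x + (- 21/256 + (1/8) * ln 2) * y^2 + (73/192
      + (- 1/2) * ln 2) * x^2 + (- 65/128 + (25/32) * ln 2) * x * y^2 + (- 25/64 + (5/8) * ln 2) * x^3"

locale two_parameter_scale = scale F r
  for F :: "'a filter" and r :: "'a \<Rightarrow> real" +
  fixes x y :: "'a \<Rightarrow> real"
  assumes x: "of_order 1 x" and y: "of_order 1 y"
begin

lemma monomial: "n \<le> i + j \<Longrightarrow> of_order n (\<lambda>p. c * x p ^ i * y p ^ j)"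
  by (rule of_order_mono[OF of_order_mult[OF of_order_cmult[OF of_order_power[OF x]] of_order_power[OF
      y]]]) simp

lemma x_lim: "(x \<longlongrightarrow> 0) F" and y_lim: "(y \<longlongrightarrow> 0) F"
  by (auto intro: of_order_tendsto_0[OF x] of_order_tendsto_0[OF y])

lemma of_order_action_poly:
  "of_order 1 (\<lambda>p. action_poly (x p) (y p))"
proof -
  \<comment> \<open>Pattern of this and the following lemmas: the expression is expanded into terms
    \<open>c * x^i * y^j\<close>, zero exponents included, so that \<open>monomial\<close> reads
    each order off \<open>i + j\<close>.\<close>
  have "action_poly x y
     = (- 2) * x^1 * y^0
       + (1/8) * x^0 * y^2
       + (11/2) * x^2 * y^0
       + (13/32) * x^1 * y^2
       + (- 79/8) * x^3 * y^0
       + (1/1024) * x^0 * y^4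
       + (65/128) * x^2 * y^2
       + (993/64) * x^4 * y^0" for x y :: real
    unfolding action_poly_def by (simp add: eval_nat_numeral field_simps)
  then show ?thesis by (simp only:) (intro of_order_add monomial, simp_all)
qed

lemma of_order_logarg_poly:
  "of_order 1 (\<lambda>p. logarg_poly (x p) (y p))"
proof -
  have "logarg_poly x y
     = (- 1) * x^1 * y^0
       + (- 1/16) * x^0 * y^2
       + (- 3/4) * x^2 * y^0" for x y :: real
    unfolding logarg_poly_def by (simp add: eval_nat_numeral field_simps)
  then show ?thesis by (simp only:) (intro of_order_add monomial, simp_all)
qed

lemma of_order_re_eps:
  "of_order 1 (\<lambda>p. re_eps (x p) (y p))"
proof -
  have "re_eps x y
     = (- 13/4) * x^1 * y^0
       + (- 3/16) * x^0 * y^2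
       + (105/16) * x^2 * y^0" for x y :: real
    unfolding re_eps_def by (simp add: eval_nat_numeral field_simps)
  then show ?thesis by (simp only:) (intro of_order_add monomial, simp_all)
qed

lemma of_order_im_eps:
  "of_order 1 (\<lambda>p. im_eps (x p) (y p))"
proof -
  have "im_eps x y
     = (- 5/8) * x^0 * y^1
       + (- 5/32) * x^1 * y^1" for x y :: real
    unfolding im_eps_def by (simp add: eval_nat_numeral field_simps)
  then show ?thesis by (simp only:) (intro of_order_add monomial, simp_all)
qed

lemma action_poly_square_approx:
  "of_order 5 (\<lambda>p. action_poly (x p) (y p) * action_poly (x p) (y p) - action_poly2 (x p) (y p))"
proof -
  have "action_poly x y * action_poly x y - action_poly2 x y
     = (25/256) * x^1 * y^4
       + (- 1/32) * x^3 * y^2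
       + (- 2731/16) * x^5 * y^0
       + (1/4096) * x^0 * y^6
       + (155/512) * x^2 * y^4
       + (369/256) * x^4 * y^2
       + (4291/16) * x^6 * y^0
       + (13/16384) * x^1 * y^6
       + (1611/4096) * x^3 * y^4
       + (2639/1024) * x^5 * y^2
       + (- 78447/256) * x^7 * y^0
       + (1/1048576) * x^0 * y^8
       + (65/65536) * x^2 * y^6
       + (9443/32768) * x^4 * y^4
       + (64545/4096) * x^6 * y^2
       + (986049/4096) * x^8 * y^0" for x y :: real
    unfolding action_poly_def action_poly2_def by (simp add: eval_nat_numeral field_simps)
  then show ?thesis by (simp only:) (intro of_order_add monomial, simp_all)
qed

lemma action_poly_cube_approx:
  "of_order 5 (\<lambda>p. action_poly (x p) (y p) * action_poly2 (x p) (y p) - action_poly3 (x p) (y p))"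
proof -
  have "action_poly x y * action_poly2 x y - action_poly3 x y
     = (- 3/32) * x^1 * y^4
       + (- 27/8) * x^3 * y^2
       + (- 300) * x^5 * y^0
       + (1/512) * x^0 * y^6
       + (- 37/256) * x^2 * y^4
       + (43/8) * x^4 * y^2
       + (10607/16) * x^6 * y^0
       + (3/512) * x^1 * y^6
       + (- 17/32) * x^3 * y^4
       + (95/8) * x^5 * y^2
       + (- 8241/8) * x^7 * y^0
       + (1/65536) * x^0 * y^8
       + (63/8192) * x^2 * y^6
       + (47/256) * x^4 * y^4
       + (16149/512) * x^6 * y^2
       + (277047/256) * x^8 * y^0" for x y :: real
    unfolding action_poly_def action_poly2_def action_poly3_def by (simp add: eval_nat_numeral field_simps)
  then show ?thesis by (simp only:) (intro of_order_add monomial, simp_all)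
qed

lemma action_poly_fourth_power_approx:
  "of_order 5 (\<lambda>p. action_poly2 (x p) (y p) * action_poly2 (x p) (y p) - action_poly4 (x p) (y p))"
proof -
  have "action_poly2 x y * action_poly2 x y - action_poly4 x y
     = (- 4) * x^3 * y^2
       + (- 176) * x^5 * y^0
       + (3/8) * x^2 * y^4
       + (20) * x^4 * y^2
       + (1042) * x^6 * y^0
       + (- 1/64) * x^1 * y^6
       + (- 7/16) * x^3 * y^4
       + (- 235/4) * x^5 * y^2
       + (- 3069) * x^7 * y^0
       + (1/4096) * x^0 * y^8
       + (- 1/128) * x^2 * y^6
       + (287/128) * x^4 * y^4
       + (- 279/8) * x^6 * y^2
       + (77841/16) * x^8 * y^0" for x y :: real
    unfolding action_poly2_def action_poly4_def by (simp add: eval_nat_numeral field_simps)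
  then show ?thesis by (simp only:) (intro of_order_add monomial, simp_all)
qed

lemma energy_poly_approx:
  "of_order 5 (\<lambda>p. (action_poly (x p) (y p) + (3 * action_poly2 (x p) (y p) + y p^2)/8
      - 17/64 * action_poly3 (x p) (y p) - 9/64 * action_poly (x p) (y p) * y p^2
      + 375/1024 * action_poly4 (x p) (y p) + 258/1024 * action_poly2 (x p) (y p) * y p^2
      + 11/1024 * y p^4) * (1 + x p)^4 - (1 - (1 + x p)^2 + y p^2 * (1 + x p)^6 / 4))"
proof -
  have "(action_poly x y + (3 * action_poly2 x y + y^2)/8 - 17/64 * action_poly3 x y
      - 9/64 * action_poly x y * y^2 + 375/1024 * action_poly4 x y
      + 258/1024 * action_poly2 x y * y^2 + 11/1024 * y^4) * (1 + x)^4 - (1 - (1 + x)^2 + y^2 * (1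
      + x)^6 / 4)
     = (- 375/2048) * x^1 * y^4
       + (- 2127/512) * x^3 * y^2
       + (50) * x^5 * y^0
       + (249/65536) * x^0 * y^6
       + (- 7101/8192) * x^2 * y^4
       + (- 5019/4096) * x^4 * y^2
       + (123) * x^6 * y^0
       + (249/16384) * x^1 * y^6
       + (- 3351/2048) * x^3 * y^4
       + (37521/1024) * x^5 * y^2
       + (104) * x^7 * y^0
       + (747/32768) * x^2 * y^6
       + (- 6303/4096) * x^4 * y^4
       + (155103/2048) * x^6 * y^2
       + (30) * x^8 * y^0
       + (249/16384) * x^3 * y^6
       + (- 369/512) * x^5 * y^4
       + (58791/1024) * x^7 * y^2
       + (249/65536) * x^4 * y^6
       + (- 1101/8192) * x^6 * y^4
       + (63045/4096) * x^8 * y^2" for x y :: real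
    unfolding action_poly_def action_poly2_def action_poly3_def action_poly4_def by (simp add:
        eval_nat_numeral field_simps)
  then show ?thesis by (simp only:) (intro of_order_add monomial, simp_all)
qed

text \<open>The same polynomial that inverts the normal form also reproduces the coefficient of the
  logarithm. Together with \<open>energy_poly_approx\<close> this is the algebraic content of their
  agreement.\<close>

lemma log_coeff_poly_approx:
  "of_order 5 (\<lambda>p. action_poly (x p) (y p) * (1 + x p)^3 - 2 * log_coeff (2 * x p
      + x p^2) (disc_poly (x p) (y p)))"
proof -
  have "action_poly x y * (1 + x)^3 - 2 * log_coeff (2 * x + x^2) (disc_poly x y)
     = (- 9/1024) * x^1 * y^4
       + (137/64) * x^3 * y^2
       + (1419/64) * x^5 * y^0
       + (- 63/1024) * x^2 * y^4
       + (613/512) * x^4 * y^2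
       + (4677/128) * x^6 * y^0
       + (- 179/1024) * x^3 * y^4
       + (31/256) * x^5 * y^2
       + (1981/128) * x^7 * y^0
       + (- 225/1024) * x^4 * y^4
       + (- 45/512) * x^6 * y^2
       + (- 5/1024) * x^8 * y^0" for x y :: real
    unfolding action_poly_def disc_poly_def log_coeff_def by (simp add: eval_nat_numeral field_simps)
  then show ?thesis by (simp only:) (intro of_order_add monomial, simp_all)
qed

lemma disc_poly_approx:
  "of_order 5 (\<lambda>p. y p^2 * (1 + x p)^6 / 4 - disc_poly (x p) (y p))"
proof -
  have "y^2 * (1 + x)^6 / 4 - disc_poly x y
     = (5) * x^3 * y^2
       + (15/4) * x^4 * y^2
       + (3/2) * x^5 * y^2
       + (1/4) * x^6 * y^2" for x y :: real
    unfolding disc_poly_def by (simp add: eval_nat_numeral field_simps)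
  then show ?thesis by (simp only:) (intro of_order_add monomial, simp_all)
qed

lemma sqrt_poly_approx:
  "of_order 4 (\<lambda>p. sqrt_taylor (2 * x p + x p^2 + disc_poly (x p) (y p)) - sqrt_poly (x p) (y p))"
proof -
  have "sqrt_taylor (2 * x + x^2 + disc_poly x y) - sqrt_poly x y
     = (- 1/128) * x^0 * y^4
       + (- 23/8) * x^2 * y^2
       + (- 7/8) * x^4 * y^0
       + (- 15/128) * x^1 * y^4
       + (- 57/16) * x^3 * y^2
       + (- 3/8) * x^5 * y^0
       + (- 1/1024) * x^0 * y^6
       + (- 207/256) * x^2 * y^4
       + (- 315/64) * x^4 * y^2
       + (- 1/16) * x^6 * y^0
       + (- 9/512) * x^1 * y^6
       + (- 99/32) * x^3 * y^4
       + (- 99/32) * x^5 * y^2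
       + (- 153/1024) * x^2 * y^6
       + (- 27/4) * x^4 * y^4
       + (- 45/64) * x^6 * y^2
       + (- 189/256) * x^3 * y^6
       + (- 945/128) * x^5 * y^4
       + (- 2295/1024) * x^4 * y^6
       + (- 675/256) * x^6 * y^4
       + (- 2025/512) * x^5 * y^6
       + (- 3375/1024) * x^6 * y^6" for x y :: real
    unfolding disc_poly_def sqrt_poly_def sqrt_taylor_def by (simp add: eval_nat_numeral field_simps)
  then show ?thesis by (simp only:) (intro of_order_add monomial, simp_all)
qed

lemma logarg_poly_approx:
  "of_order 3 (\<lambda>p. (2 * sqrt_poly (x p) (y p) - 2 - (2 * x p + x p^2)) / 4
      - logarg_poly (x p) (y p))"
proof -
  have "(2 * sqrt_poly x y - 2 - (2 * x + x^2)) / 4 - logarg_poly x y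
     = (- 7/16) * x^1 * y^2
       + (- 1/2) * x^3 * y^0" for x y :: real
    unfolding sqrt_poly_def logarg_poly_def by (simp add: eval_nat_numeral field_simps)
  then show ?thesis by (simp only:) (intro of_order_add monomial, simp_all)
qed

lemma log_poly_approx:
  "of_order 3 (\<lambda>p. logarg_poly (x p) (y p) - logarg_poly (x p) (y p) ^ 2 / 2
      - log_poly (x p) (y p))"
proof -
  have "logarg_poly x y - logarg_poly x y ^ 2 / 2 - log_poly x y
     = (- 1/16) * x^1 * y^2
       + (- 3/4) * x^3 * y^0
       + (- 1/512) * x^0 * y^4
       + (- 3/64) * x^2 * y^2
       + (- 9/32) * x^4 * y^0" for x y :: real
    unfolding logarg_poly_def log_poly_def by (simp add: eval_nat_numeral field_simps)
  then show ?thesis by (simp only:) (intro of_order_add monomial, simp_all)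
qed

lemma re_poly_approx:
  "of_order 4 (\<lambda>p. - (2 * x p + x p^2 + 2 * disc_poly (x p) (y p)) - re_poly (x p) (y p))"
proof -
  have "- (2 * x + x^2 + 2 * disc_poly x y) - re_poly x y
     = (- 15/2) * x^2 * y^2" for x y :: real
    unfolding disc_poly_def re_poly_def by (simp add: eval_nat_numeral field_simps)
  then show ?thesis by (simp only:) (intro of_order_add monomial, simp_all)
qed

lemma im_poly_approx:
  "of_order 4 (\<lambda>p. y p * (1 + x p)^3 * sqrt_poly (x p) (y p) - im_poly (x p) (y p))"
proof -
  have "y * (1 + x)^3 * sqrt_poly x y - im_poly x y
     = (- 5/4) * x^1 * y^3
       + (- 6) * x^3 * y^1
       + (- 3) * x^2 * y^3
       + (- 7) * x^4 * y^1
       + (- 11/4) * x^3 * y^3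
       + (- 4) * x^5 * y^1
       + (- 7/8) * x^4 * y^3
       + (- 1) * x^6 * y^1" for x y :: real
    unfolding sqrt_poly_def im_poly_def by (simp add: eval_nat_numeral field_simps)
  then show ?thesis by (simp only:) (intro of_order_add monomial, simp_all)
qed

text \<open>With \<open>im_eps_approx\<close>, the real and imaginary parts of
  \<open>j1 + \<i> * y = w * (1 + eps)\<close> modulo degree four. Divisibility by \<open>w\<close>,
  whose linear part is \<open>- 2 * x + \<i> * y\<close>, is a genuine condition on the
  coefficients; without it the quotient would depend on the direction of approach beyond leading
  order.\<close>

lemma re_eps_approx:
  "of_order 4 (\<lambda>p. action_poly (x p) (y p) - (re_poly (x p) (y p) * (1 + re_eps (x p) (y p))
      - im_poly (x p) (y p) * im_eps (x p) (y p)))"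
proof -
  have "action_poly x y - (re_poly x y * (1 + re_eps x y) - im_poly x y * im_eps x y)
     = (- 15/1024) * x^0 * y^4
       + (- 747/128) * x^2 * y^2
       + (1413/64) * x^4 * y^0
       + (- 139/256) * x^1 * y^4
       + (635/32) * x^3 * y^2" for x y :: real
    unfolding action_poly_def re_poly_def im_poly_def re_eps_def im_eps_def by (simp add:
        eval_nat_numeral field_simps)
  then show ?thesis by (simp only:) (intro of_order_add monomial, simp_all)
qed

lemma im_eps_approx:
  "of_order 4 (\<lambda>p. y p - (re_poly (x p) (y p) * im_eps (x p) (y p) + im_poly (x p) (y p) * (1
      + re_eps (x p) (y p))))"
proof -
  have "y - (re_poly x y * im_eps x y + im_poly x y * (1 + re_eps x y))
     = (- 127/64) * x^1 * y^3
       + (- 529/32) * x^3 * y^1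
       + (- 3/128) * x^0 * y^5
       + (21/128) * x^2 * y^3
       + (105/16) * x^4 * y^1" for x y :: real
    unfolding re_poly_def im_poly_def re_eps_def im_eps_def by (simp add: eval_nat_numeral field_simps)
  then show ?thesis by (simp only:) (intro of_order_add monomial, simp_all)
qed

lemma re_log_approx:
  "of_order 3 (\<lambda>p. re_eps (x p) (y p) - (re_eps (x p) (y p) ^ 2 - im_eps (x p) (y p) ^ 2) / 2
      - re_log (x p) (y p))"
proof -
  have "re_eps x y - (re_eps x y ^ 2 - im_eps x y ^ 2) / 2 - re_log x y
     = (- 131/256) * x^1 * y^2
       + (1365/64) * x^3 * y^0
       + (- 9/512) * x^0 * y^4
       + (2545/2048) * x^2 * y^2
       + (- 11025/512) * x^4 * y^0" for x y :: real
    unfolding re_eps_def im_eps_def re_log_def by (simp add: eval_nat_numeral field_simps)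
  then show ?thesis by (simp only:) (intro of_order_add monomial, simp_all)
qed

lemma im_log_approx:
  "of_order 3 (\<lambda>p. im_eps (x p) (y p) - re_eps (x p) (y p) * im_eps (x p) (y p)
      - im_log (x p) (y p))"
proof -
  have "im_eps x y - re_eps x y * im_eps x y - im_log x y
     = (- 15/128) * x^0 * y^3
       + (115/32) * x^2 * y^1
       + (- 15/512) * x^1 * y^3
       + (525/512) * x^3 * y^1" for x y :: real
    unfolding re_eps_def im_eps_def im_log_def by (simp add: eval_nat_numeral field_simps)
  then show ?thesis by (simp only:) (intro of_order_add monomial, simp_all)
qed

lemma angle_poly_approx:
  "of_order 4 (\<lambda>p. action_poly (x p) (y p) * re_log (x p) (y p) - y p * im_log (x p) (y p)
      - angle_poly (x p) (y p))"
proof -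
  have "action_poly x y * re_log x y - y * im_log x y - angle_poly x y
     = (1/1024) * x^0 * y^4
       + (- 143/128) * x^2 * y^2
       + (2505/64) * x^4 * y^0
       + (- 309/256) * x^3 * y^2
       + (- 4037/64) * x^5 * y^0
       + (1/131072) * x^0 * y^6
       + (171/32768) * x^2 * y^4
       + (6323/8192) * x^4 * y^2
       + (40713/2048) * x^6 * y^0" for x y :: real
    unfolding action_poly_def re_log_def im_log_def angle_poly_def by (simp add: eval_nat_numeral
        field_simps)
  then show ?thesis by (simp only:) (intro of_order_add monomial, simp_all)
qed

lemma coeff_poly_approx:
  "of_order 4 (\<lambda>p. sqrt_coeff (2 * x p + x p^2) (disc_poly (x p) (y p)) 1 - coeff_poly (x p) (y p))"
proof -
  have "sqrt_coeff (2 * x + x^2) (disc_poly x y) 1 - coeff_poly x y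
     = (739/3072) * x^2 * y^2
       + (119/1536) * x^4 * y^0
       + (39/256) * x^3 * y^2
       + (15/512) * x^5 * y^0
       + (65/1024) * x^4 * y^2
       + (5/1024) * x^6 * y^0" for x y :: real
    unfolding disc_poly_def coeff_poly_def sqrt_coeff_def by (simp add: eval_nat_numeral field_simps)
  then show ?thesis by (simp only:) (intro of_order_add monomial, simp_all)
qed

lemma moment_poly_approx:
  "of_order 4 (\<lambda>p. moment_part (2 * x p + x p^2) (disc_poly (x p) (y p)) - moment_poly (x p) (y p))"
proof -
  have "moment_part (2 * x + x^2) (disc_poly x y) - moment_poly x y
     = (- 341/256 + (133/64) * ln 2) * x^2 * y^2
       + (- 45/256 + (5/16) * ln 2) * x^4 * y^0
       + (- 9/32 + (9/16) * ln 2) * x^3 * y^2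
       + (- 3/64 + (3/32) * ln 2) * x^5 * y^0
       + (- 15/128 + (15/64) * ln 2) * x^4 * y^2
       + (- 1/128 + (1/64) * ln 2) * x^6 * y^0" for x y :: real
    unfolding disc_poly_def moment_poly_def moment_part_def by (simp add: eval_nat_numeral field_simps)
  then show ?thesis by (simp only:) (intro of_order_add monomial, simp_all)
qed

text \<open>Here the constant 4/3 and the coefficients of the invariant are matched. The term
  \<open>- 2 * ln 2 * A\<close> is \<open>2 * ln 2\<close> from the \<open>ln 4\<close> split off
  the logarithm minus \<open>4 * ln 2\<close> from \<open>ln 16\<close>; it cancels the
  \<open>ln 2\<close> of the moments through degree three.\<close>

lemma expansion_poly_cancels:
  "of_order 4 (\<lambda>p. 2 * (coeff_poly (x p) (y p) * sqrt_poly (x p) (y p)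
      + moment_poly (x p) (y p)) - (1 + x p)^3 * (4/3) + (1 + x p)^3 * (action_poly (x p) (y p) *
      log_poly (x p) (y p) - 2 * ln 2 * action_poly (x p) (y p) - action_poly (x p) (y p)
      - ((17 * action_poly2 (x p) (y p) + 3 * y p^2)/16 - (125 * action_poly3 (x p) (y p)
      + 43 * action_poly (x p) (y p) * y p^2)/128) + angle_poly (x p) (y p)))"
proof -
  have "2 * (coeff_poly x y * sqrt_poly x y + moment_poly x y) - (1 + x)^3 * (4/3) + (1
      + x)^3 * (action_poly x y * log_poly x y - 2 * ln 2 * action_poly x y - action_poly x y
      - ((17 * action_poly2 x y + 3 * y^2)/16 - (125 * action_poly3 x y
      + 43 * action_poly x y * y^2)/128) + angle_poly x y)
     = (83/6144 + (- 1/512) * ln 2) * x^0 * y^4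
       + (193/32 + (- 269/64) * ln 2) * x^2 * y^2
       + (- 3673/192 + (- 25/32) * ln 2) * x^4 * y^0
       + (1445/12288 + (- 3/512) * ln 2) * x^1 * y^4
       + (18901/3072 + (- 367/64) * ln 2) * x^3 * y^2
       + (- 2099/32 + (- 1435/32) * ln 2) * x^5 * y^0
       + (35/131072) * x^0 * y^6
       + (18337/49152 + (- 3/512) * ln 2) * x^2 * y^4
       + (- 4783/24576 + (- 247/64) * ln 2) * x^4 * y^2
       + (- 71927/768 + (- 2347/32) * ln 2) * x^6 * y^0
       + (105/131072) * x^1 * y^6
       + (12449/16384 + (- 1/512) * ln 2) * x^3 * y^4
       + (15073/8192 + (- 65/64) * ln 2) * x^5 * y^2
       + (- 23007/256 + (- 993/32) * ln 2) * x^7 * y^0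
       + (105/131072) * x^2 * y^6
       + (8569/16384) * x^4 * y^4
       + (58225/8192) * x^6 * y^2
       + (- 15707/256) * x^8 * y^0
       + (35/131072) * x^3 * y^6
       + (2255/16384) * x^5 * y^4
       + (29555/8192) * x^7 * y^2
       + (- 4965/256) * x^9 * y^0" for x y :: real
    unfolding action_poly_def action_poly2_def action_poly3_def sqrt_poly_def log_poly_def
        angle_poly_def coeff_poly_def moment_poly_def by (simp add: eval_nat_numeral field_simps)
  then show ?thesis by (simp only:) (intro of_order_add monomial, simp_all)
qed

end

section \<open>Expansion of the action\<close>

text \<open>In the closed upper half-plane \<open>pi - Arg z\<close> lies in \<open>[0, pi]\<close>,
  the range of the arccosine.\<close>

lemma arccos_eq_Arg:
  assumes "z \<noteq> 0" "Im z \<ge> 0"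
  shows "arccos (- Re z / cmod z) = pi - Arg z"
proof -
  have "Re z = cmod z * cos (Arg z)"
    by (metis Re_rcis rcis_cmod_Arg)
  then have "- Re z / cmod z = cos (pi - Arg z)" using assms(1) by simp
  moreover have "0 \<le> pi - Arg z" "pi - Arg z \<le> pi"
    using Arg_le_pi[of z] Arg_less_0[of z] assms(2) by auto
  ultimately show ?thesis by (simp only: arccos_cos)
qed

text \<open>Both arguments lie in \<open>[0, pi]\<close>, so their difference is a principal value
  unless it equals \<open>- pi\<close>; in that case the quotient would be negative and could not be
  close to 1.\<close>

lemma Ln_divide_upper_half_plane:
  assumes z: "z \<noteq> 0" "Im z \<ge> 0" and w: "w \<noteq> 0" "Im w \<ge> 0" and near: "cmod (z / w
      - 1) < 1"
  shows "Ln (z / w) = Ln z - Ln w"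
proof -
  have e: "exp (Ln z - Ln w) = z / w" using z w by (simp add: exp_diff)
  have I: "\<bar>Im (Ln z - Ln w)\<bar> \<le> pi"
    using Im_Ln_pos_le[OF z(1)] Im_Ln_pos_le[OF w(1)] z w by auto
  have "Im (Ln z - Ln w) \<noteq> - pi"
  proof
    assume "Im (Ln z - Ln w) = - pi"
    then have "Re (z / w) = - exp (Re (Ln z - Ln w))"
      unfolding e[symmetric] Re_exp by simp
    then have "Re (z / w) < 0" by (metis exp_gt_zero neg_less_0_iff_less)
    moreover have "\<bar>Re (z / w - 1)\<bar> < 1" using near abs_Re_le_cmod le_less_trans by blast
    ultimately show False by simp
  qed
  with I show ?thesis by (metis Ln_unique abs_le_iff e minus_le_iff order_le_less)
qed

text \<open>Here \<open>a\<close> stands for \<open>j1\<close>, \<open>y\<close> for the absolute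
  value of \<open>j2\<close>, \<open>h\<close> for the energy and \<open>x\<close> for
  \<open>m - 1\<close>. The parameter enters only through its order and the energy equation, so it
  may be chosen pointwise.\<close>

locale champagne_asymptotics = two_parameter_scale F r x y
  for F :: "'a filter" and r x y :: "'a \<Rightarrow> real" +
  fixes a h :: "'a \<Rightarrow> real"
  assumes r_norm: "eventually (\<lambda>p. r p = sqrt (a p ^ 2 + y p ^ 2)) F"
    and y_nonneg: "eventually (\<lambda>p. y p \<ge> 0) F"
    and energy: "of_order 5 (\<lambda>p. h p - Hbar5 (a p) (y p))"
    and parameter: "eventually (\<lambda>p. h p = (1 - (1 + x p)^2) / (1 + x p)^4 + y p ^2 * (1
        + x p)^2 / 4) F"
begin

abbreviation m where "m p \<equiv> 1 + x p"
abbreviation t where "t p \<equiv> 2 * x p + x p ^ 2"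
abbreviation Q where "Q p \<equiv> y p ^ 2 * m p ^ 6 / 4"
abbreviation Q5 where "Q5 p \<equiv> disc_poly (x p) (y p)"
abbreviation A where "A p \<equiv> action_poly (x p) (y p)"
abbreviation A2 where "A2 p \<equiv> action_poly2 (x p) (y p)"
abbreviation A3 where "A3 p \<equiv> action_poly3 (x p) (y p)"
abbreviation A4 where "A4 p \<equiv> action_poly4 (x p) (y p)"
abbreviation s where "s p \<equiv> sqrt (1 - t p - Q p)"
abbreviation L where "L p \<equiv> 2 * log_coeff (t p) (Q p) / m p ^ 3"

lemmas bounded_intros = of_order_const of_order_add of_order_diff of_order_minus
  of_order_mult[of 0 _ 0, simplified] of_order_power[of 0, simplified] of_order_divide_const

lemma x_bounded: "of_order 0 x" and y_bounded: "of_order 0 y"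
  by (auto intro: of_order_mono[OF x] of_order_mono[OF y])

lemma A_bounded: "of_order 0 (\<lambda>p. A p)"
  by (rule of_order_mono[OF of_order_action_poly]) simp

lemma poly_bounded:
  "of_order 0 (\<lambda>p. A2 p)" "of_order 0 (\<lambda>p. Q5 p)" "of_order 0 (\<lambda>p. sqrt_poly (x
      p) (y p))"
  "of_order 0 (\<lambda>p. re_poly (x p) (y p))" "of_order 0 (\<lambda>p. im_poly (x p) (y p))"
  "of_order 0 (\<lambda>p. re_eps (x p) (y p))" "of_order 0 (\<lambda>p. im_eps (x p) (y p))"
  "of_order 0 (\<lambda>p. re_log (x p) (y p))" "of_order 0 (\<lambda>p. im_log (x p) (y p))"
  "of_order 0 (\<lambda>p. log_poly (x p) (y p))"
  unfolding action_poly2_def disc_poly_def sqrt_poly_def re_poly_def im_poly_def re_eps_def im_eps_def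
    re_log_def im_log_def log_poly_def
  by (intro bounded_intros x_bounded y_bounded)+

lemma of_order_a: "of_order 1 a"
proof -
  from r_norm have "eventually (\<lambda>p. norm (a p) \<le> 1 * r p ^ 1) F"
    by eventually_elim (auto intro!: real_le_rsqrt)
  then show ?thesis unfolding of_order_def by blast
qed

lemma a_lim: "(a \<longlongrightarrow> 0) F"
  by (rule of_order_tendsto_0[OF of_order_a]) simp

lemma A_lim: "((\<lambda>p. A p) \<longlongrightarrow> 0) F"
  by (rule of_order_tendsto_0[OF of_order_action_poly]) simp

lemma m_nonzero: "eventually (\<lambda>p. m p > 0) F"
  using order_tendstoD(1)[OF x_lim, of "-1"] by (auto elim: eventually_mono)

lemma inverse_m_bounded: "of_order 0 (\<lambda>p. 1 / m p ^ k)"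
proof (rule of_order_tendsto)
  show "((\<lambda>p. 1 / m p ^ k) \<longlongrightarrow> 1 / (1 + 0) ^ k) F"
    by (intro tendsto_intros x_lim) auto
qed

lemma of_order_divide_m: "of_order n f \<Longrightarrow> of_order n (\<lambda>p. f p / m p ^ k)"
  using of_order_mult[OF _ inverse_m_bounded, of n f k] by simp

section \<open>The coefficient of the logarithm and the momentum \<open>j1\<close>\<close>

lemma energy_expansion:
  "of_order 5 (\<lambda>p. Hbar5 (A p) (y p) - Hbar5 (a p) (y p))"
proof -
  have 1: "of_order 5 (\<lambda>p. Hbar5 (A p) (y p) * m p ^ 4 - (1 - m p ^ 2 + y p ^ 2 * m p ^ 6 / 4))"
  proof -
    \<comment> \<open>Truncated powers are exchanged for true ones through
      \<open>A^3 - A3 = A * ?e2 + ?e3\<close> and \<open>A^4 - A4 = (A^2 + A2) * ?e2 + ?e4\<close>;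
      \<open>?c\<close> gathers the multipliers of \<open>?e2\<close>, and \<open>?N\<close> is the
      quintic part of the normal form.\<close>
    let ?e2 = "\<lambda>p. A p * A p - A2 p" and ?e3 = "\<lambda>p. A p * A2 p - A3 p" and ?e4
        = "\<lambda>p. A2 p * A2 p - A4 p"
    let ?P = "\<lambda>p. (A p + (3 * A2 p + y p ^ 2)/8 - 17/64 * A3 p - 9/64 * A p * y p ^ 2
        + 375/1024 * A4 p
        + 258/1024 * A2 p * y p ^ 2 + 11/1024 * y p ^ 4) * m p ^ 4 - (1 - m p ^ 2 + y p ^ 2 * m p ^ 6 / 4)"
    let ?N = "\<lambda>p. A p * (10689 * A p ^ 4 + 8910 * A p ^ 2 * y p ^ 2 + 909 * y p ^ 4) / 16384"
    let ?c = "\<lambda>p. 3/8 - 17/64 * A p + 375/1024 * (A p ^ 2 + A2 p) + 258/1024 * y p ^ 2"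
    have c: "of_order 0 ?c" and m: "of_order 0 (\<lambda>p. m p ^ 4)"
      by (intro bounded_intros A_bounded poly_bounded x_bounded y_bounded)+
    have y4: "of_order 4 (\<lambda>p. 10689 * A p ^ 4 + 8910 * (A p ^ 2 * y p ^ 2) + 909 * y p ^ 4)"
      by (intro of_order_add of_order_cmult of_order_power'[OF y] of_order_power'[OF of_order_action_poly]
            of_order_mult'[OF of_order_power[OF of_order_action_poly] of_order_power[OF y]]) auto
    have N: "of_order 5 ?N"
      using of_order_divide_const[OF of_order_mult'[OF of_order_action_poly y4, of 5], of 16384] by
          (simp add: mult.assoc)
    have "of_order 5 (\<lambda>p. ?P p + (?e2 p * ?c p - 17/64 * ?e3 p + 375/1024 * ?e4 p
        - ?N p) * m p ^ 4)"
      by (rule of_order_add[OF energy_poly_approx], rule of_order_mult'[OF _ m],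
          rule of_order_diff[OF of_order_add[OF of_order_diff[OF of_order_mult'[OF
              action_poly_square_approx c]
            of_order_cmult[OF action_poly_cube_approx]] of_order_cmult[OF
                action_poly_fourth_power_approx]] N]) auto
    moreover have "?P p + (?e2 p * ?c p - 17/64 * ?e3 p + 375/1024 * ?e4 p - ?N p) * m p ^ 4
        = Hbar5 (A p) (y p) * m p ^ 4 - (1 - m p ^ 2 + y p ^ 2 * m p ^ 6 / 4)" for p
    proof -
      have "A p + (3 * A2 p + y p ^ 2)/8 - 17/64 * A3 p - 9/64 * A p * y p ^ 2 + 375/1024 * A4 p
        + 258/1024 * A2 p * y p ^ 2 + 11/1024 * y p ^ 4 + (?e2 p * ?c p - 17/64 * ?e3 p
            + 375/1024 * ?e4 p - ?N p)
        = Hbar5 (A p) (y p)"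
        unfolding Hbar5_def by (simp add: eval_nat_numeral field_simps)
      moreover have "(b * c - z) + d * c = (b + d) * c - z" for b c d z :: real
        by (simp add: algebra_simps)
      ultimately show ?thesis by (simp only:)
    qed
    ultimately show ?thesis by (simp only:)
  qed
  have "of_order 5 (\<lambda>p. Hbar5 (A p) (y p) - h p)"
  proof (rule of_order_cong[OF of_order_divide_m[OF 1, of 4]])
    show "eventually (\<lambda>p. Hbar5 (A p) (y p) - h p =
        (Hbar5 (A p) (y p) * m p ^ 4 - (1 - m p ^ 2 + y p ^ 2 * m p ^ 6 / 4)) / m p ^ 4) F"
      using parameter m_nonzero
    proof eventually_elim
      case (elim p)
      have "(1 - m p ^ 2 + y p ^ 2 * m p ^ 6 / 4) / m p ^ 4 = h p"
      proof -
        have "(1 - c^2 + z * c^6/4) / c^4 = (1 - c^2)/c^4 + z * c^2/4" if "c > 0" for c z :: real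
          using that by (simp add: eval_nat_numeral field_simps)
        then show ?thesis unfolding elim(1) using elim(2) by blast
      qed
      then show ?case using elim(2) by (simp add: diff_divide_distrib)
    qed
  qed
  from of_order_trans[OF this energy] show ?thesis .
qed

text \<open>The divided difference \<open>K\<close> of the normal form in its first argument tends
  to 1, so closeness of the energies passes to their arguments without loss of order.\<close>

lemma action_approx: "of_order 5 (\<lambda>p. A p - a p)"
proof -
  define K where "K = (\<lambda>p. 1 + 3 * (A p + a p) / 8 - (17 * (A p ^ 2 + A p * a p + a p ^ 2)
      + 9 * y p ^ 2) / 64
    + (375 * ((A p ^ 2 + a p ^ 2) * (A p + a p)) + 258 * ((A p + a p) * y p ^ 2)) / 1024
    - (10689 * (A p ^ 4 + A p ^ 3 * a p + A p ^ 2 * a p ^ 2 + A p * a p ^ 3 + a p ^ 4)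
       + 8910 * ((A p ^ 2 + A p * a p + a p ^ 2) * y p ^ 2) + 909 * y p ^ 4) / 16384)"
  have K: "Hbar5 (A p) (y p) - Hbar5 (a p) (y p) = (A p - a p) * K p" for p
    unfolding Hbar5_def K_def by (simp add: eval_nat_numeral field_simps)
  have "(K \<longlongrightarrow> 1) F"
    unfolding K_def using A_lim a_lim y_lim
    by (auto intro!: tendsto_eq_intros)
  then have "eventually (\<lambda>p. K p > 1/2) F" by (rule order_tendstoD) simp
  then have "eventually (\<lambda>p. norm (A p - a p) \<le> 2 * norm (Hbar5 (A p) (y p)
      - Hbar5 (a p) (y p))) F"
  proof eventually_elim
    case (elim p)
    have "\<bar>A p - a p\<bar> * 1 \<le> \<bar>A p - a p\<bar> * (2 * \<bar>K p\<bar>)" using elim by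
        (intro mult_left_mono) auto
    then show ?case by (simp add: K abs_mult)
  qed
  with energy_expansion show ?thesis by (rule of_order_le)
qed

lemma t_order: "of_order 1 (\<lambda>p. t p)"
  by (intro of_order_add of_order_cmult x of_order_power'[OF x]) auto

lemma t_lim: "((\<lambda>p. t p) \<longlongrightarrow> 0) F"
  by (rule of_order_tendsto_0[OF t_order]) simp

lemma Q_lim: "((\<lambda>p. Q p) \<longlongrightarrow> 0) F"
  using x_lim y_lim by (auto intro!: tendsto_eq_intros)

lemma log_coeff_approx: "of_order 5 (\<lambda>p. L p - A p)"
proof -
  have "of_order 0 (\<lambda>p. 1/4 + t p/32 + (Q p + Q5 p)/128 + 3/256 * t p ^ 2)"
    by (intro bounded_intros x_bounded y_bounded poly_bounded)
  from of_order_mult'[OF disc_poly_approx this, of 5]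
  have "of_order 5 (\<lambda>p. log_coeff (t p) (Q p) - log_coeff (t p) (Q5 p))"
  proof (rule of_order_cong)
    show "eventually (\<lambda>p. log_coeff (t p) (Q p) - log_coeff (t p) (Q5 p)
      = (Q p - Q5 p) * (1/4 + t p/32 + (Q p + Q5 p)/128 + 3/256 * t p ^ 2)) F"
    proof (rule always_eventually, rule)
      fix p
      have "log_coeff T Q' - log_coeff T Q'' = (Q' - Q'') * (1/4 + T/32 + (Q' + Q'')/128
          + 3/256 * T ^ 2)" for T Q' Q''
        unfolding log_coeff_def by (simp add: power2_eq_square field_simps)
      then show "log_coeff (t p) (Q p) - log_coeff (t p) (Q5 p)
      = (Q p - Q5 p) * (1/4 + t p/32 + (Q p + Q5 p)/128 + 3/256 * t p ^ 2)" .
    qed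
  qed simp
  note 1 = this
  have "of_order 5 (\<lambda>p. (2 * (log_coeff (t p) (Q p) - log_coeff (t p) (Q5 p))
      - (A p * m p ^ 3 - 2 * log_coeff (t p) (Q5 p))) / m p ^ 3)"
    by (rule of_order_divide_m[OF of_order_diff[OF of_order_cmult[OF 1] log_coeff_poly_approx]])
  then show ?thesis
  proof (rule of_order_cong)
    show "eventually (\<lambda>p. L p - A p = (2 * (log_coeff (t p) (Q p) - log_coeff (t p) (Q5 p))
      - (A p * m p ^ 3 - 2 * log_coeff (t p) (Q5 p))) / m p ^ 3) F"
      using m_nonzero by eventually_elim (simp add: field_simps)
  qed
qed

lemma of_order_log_coeff: "of_order 1 (\<lambda>p. L p)"
proof -
  have "of_order 1 (\<lambda>p. (L p - A p) + A p)"
    by (intro of_order_add of_order_action_poly of_order_mono[OF log_coeff_approx]) simp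
  then show ?thesis by simp
qed

lemma sqrt_approx: "of_order 4 (\<lambda>p. s p - sqrt_poly (x p) (y p))"
proof -
  let ?d = "\<lambda>p. t p + Q p" and ?d5 = "\<lambda>p. t p + Q5 p"
  have "(?d \<longlongrightarrow> 0 + 0) F" by (intro tendsto_add t_lim Q_lim)
  then have "eventually (\<lambda>p. ?d p < 1) F" by (rule order_tendstoD) simp
  then have e: "eventually (\<lambda>p. \<bar>s p - sqrt_taylor (?d p)\<bar> \<le> 1 * \<bar>?d p ^
      4\<bar>) F"
    by eventually_elim (use sqrt_taylor_error in \<open>simp add: algebra_simps\<close>)
  have "of_order 0 (\<lambda>p. m p ^ 6 / 4)"
    by (intro bounded_intros x_bounded)
  from of_order_mult'[OF of_order_power[OF y, of 2] this, of 1]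
  have "of_order 1 (\<lambda>p. Q p)" by simp
  then have d: "of_order 1 ?d" by (intro of_order_add t_order)
  from of_order_abs_le[OF of_order_power'[OF d, of 4 4] e]
  have 1: "of_order 4 (\<lambda>p. s p - sqrt_taylor (?d p))" by simp
  have "of_order 0 (\<lambda>p. - 1/2 - (?d p + ?d5 p)/8 - (?d p ^ 2 + ?d p * ?d5 p + ?d5 p ^ 2)/16)"
    by (intro bounded_intros x_bounded y_bounded poly_bounded)
  from of_order_mult'[OF disc_poly_approx this, of 4]
  have 2: "of_order 4 (\<lambda>p. sqrt_taylor (?d p) - sqrt_taylor (?d5 p))"
  proof (rule of_order_cong)
    have "sqrt_taylor (T + q) - sqrt_taylor (T + q') = (q - q') * (- 1/2 - ((T + q) + (T + q'))/8
        - ((T + q) ^ 2 + (T + q) * (T + q') + (T + q') ^ 2)/16)" for T q q'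
      unfolding sqrt_taylor_def by (simp add: eval_nat_numeral field_simps)
    then show "eventually (\<lambda>p. sqrt_taylor (?d p) - sqrt_taylor (?d5 p)
       = (Q p - Q5 p) * (- 1/2 - (?d p + ?d5 p)/8 - (?d p ^ 2 + ?d p * ?d5 p + ?d5 p ^ 2)/16)) F"
      by (intro always_eventually allI)
  qed simp
  from of_order_trans[OF of_order_trans[OF 1 2] sqrt_poly_approx] show ?thesis .
qed

text \<open>Order three is enough, because this logarithm is multiplied by \<open>L\<close>, which
  has order one.\<close>

lemma ln_approx:
  "of_order 3 (\<lambda>p. ln (1 + (2 * s p - 2 - t p) / 4) - log_poly (x p) (y p))"
proof -
  let ?w = "\<lambda>p. (2 * s p - 2 - t p) / 4" and ?v = "\<lambda>p. logarg_poly (x p) (y p)"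
  have "of_order 3 (\<lambda>p. (s p - sqrt_poly (x p) (y p)) / 2 + ((2 * sqrt_poly (x p) (y p) - 2
      - t p) / 4 - ?v p))"
    by (intro of_order_add of_order_divide_const of_order_mono[OF sqrt_approx] logarg_poly_approx) simp
  moreover have "(S - G) / 2 + ((2 * G - 2 - T) / 4 - V) = (2 * S - 2 - T) / 4 - V" for S G T V :: real
    by (simp add: field_simps)
  ultimately have wv: "of_order 3 (\<lambda>p. ?w p - ?v p)" by (simp only:)
  then have "of_order 1 (\<lambda>p. (?w p - ?v p) + ?v p)"
    by (intro of_order_add of_order_logarg_poly of_order_mono[OF wv]) simp
  then have w: "of_order 1 ?w" by simp
  have "eventually (\<lambda>p. norm (?w p) < 1/2) F"
    using of_order_tendsto_0[OF w] by (intro order_tendstoD(2)[OF tendsto_norm]) auto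
  then have e: "eventually (\<lambda>p. \<bar>ln (1 + ?w p) - (?w p
      - ?w p ^ 2/2)\<bar> \<le> 2 * \<bar>?w p ^ 3\<bar>) F"
  proof eventually_elim
    case (elim p)
    then have "\<bar>?w p\<bar> \<le> 1/2" by (simp only: real_norm_def less_imp_le)
    from abs_ln_quadratic[OF this] show ?case by (simp only: power_abs)
  qed
  from of_order_abs_le[OF of_order_power'[OF w, of 3 3] e]
  have 1: "of_order 3 (\<lambda>p. ln (1 + ?w p) - (?w p - ?w p ^ 2/2))" by simp
  have "of_order 0 (\<lambda>p. 1 - (?w p + ?v p)/2)"
    by (intro of_order_diff of_order_const of_order_divide_const of_order_add
          of_order_mono[OF w] of_order_mono[OF of_order_logarg_poly]) auto
  from of_order_mult'[OF wv this, of 3]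
  have "of_order 3 (\<lambda>p. (?w p - ?v p) * (1 - (?w p + ?v p)/2))" by simp
  moreover have "(w - v) * (1 - (w + v)/2) = (w - w^2/2) - (v - v^2/2)" for w v :: real
    by (simp add: power2_eq_square field_simps)
  ultimately have "of_order 3 (\<lambda>p. (?w p - ?w p ^ 2/2) - (?v p - ?v p ^ 2/2))" by (simp only:)
  from of_order_trans[OF of_order_trans[OF 1 this] log_poly_approx] show ?thesis .
qed

section \<open>The complex points \<open>J\<close> and \<open>J0\<close> and the logarithm of their
  quotient\<close>

abbreviation J where "J p \<equiv> Complex (a p) (y p)"
abbreviation J0 where "J0 p \<equiv> Complex (- (t p + 2 * Q p)) (y p * m p ^ 3 * s p)"
abbreviation \<epsilon> where "\<epsilon> p \<equiv> Complex (re_eps (x p) (y p)) (im_eps (x p) (y p))"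

lemma J_norm: "eventually (\<lambda>p. cmod (J p) = r p) F"
  using r_norm by eventually_elim (simp add: cmod_def)

lemma J0_approx: "of_order 4 (\<lambda>p. J p - J0 p * (1 + \<epsilon> p))"
proof -
  let ?JP = "\<lambda>p. Complex (A p) (y p)"
  let ?J0P = "\<lambda>p. Complex (re_poly (x p) (y p)) (im_poly (x p) (y p))"
  have "of_order 4 (\<lambda>p. Complex (A p - (re_poly (x p) (y p) * (1 + re_eps (x p) (y p))
      - im_poly (x p) (y p) * im_eps (x p) (y p)))
      (y p - (re_poly (x p) (y p) * im_eps (x p) (y p) + im_poly (x p) (y p) * (1 + re_eps (x p) (y p)))))"
    by (intro of_order_Complex re_eps_approx im_eps_approx)
  then have 1: "of_order 4 (\<lambda>p. ?JP p - ?J0P p * (1 + \<epsilon> p))"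
    by (rule of_order_cong) (auto simp: complex_eq_iff intro!: always_eventually)
  have "of_order 4 (\<lambda>p. Complex (- (A p - a p)) 0)"
    by (intro of_order_Complex of_order_minus of_order_zero of_order_mono[OF action_approx]) simp
  then have 2: "of_order 4 (\<lambda>p. J p - ?JP p)"
    by (rule of_order_cong) (auto simp: complex_eq_iff intro!: always_eventually)
  have "of_order 0 (\<lambda>p. y p * m p ^ 3)" by (intro bounded_intros x_bounded y_bounded)
  from of_order_mult'[OF this sqrt_approx, of 4]
  have "of_order 4 (\<lambda>p. y p * m p ^ 3 * (s p - sqrt_poly (x p) (y p)))" by simp
  then have "of_order 4 (\<lambda>p. Complex ((- (t p + 2 * Q5 p) - re_poly (x p) (y p)) - 2 * (Q p - Q5 p))
      (y p * m p ^ 3 * (s p - sqrt_poly (x p) (y p)) + (y p * m p ^ 3 * sqrt_poly (x p) (y p)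
          - im_poly (x p) (y p))))"
    by (intro of_order_Complex of_order_add[OF _ im_poly_approx] of_order_diff[OF re_poly_approx]
         of_order_cmult of_order_mono[OF disc_poly_approx]) simp_all
  moreover have "Complex ((- (T + 2 * q') - R) - 2 * (q - q')) (Y * (S - G) + (Y * G - I))
      = Complex (- (T + 2 * q)) (Y * S) - Complex R I" for T q q' R Y S G I
    by (simp add: complex_eq_iff algebra_simps)
  ultimately have 3: "of_order 4 (\<lambda>p. J0 p - ?J0P p)" by (simp only:)
  have "of_order 0 (\<lambda>p. 1 + \<epsilon> p)"
    by (intro of_order_add of_order_const of_order_Complex poly_bounded)
  from of_order_mult'[OF 3 this, of 4]
  have "of_order 4 (\<lambda>p. (J0 p - ?J0P p) * (1 + \<epsilon> p))" by simp
  from of_order_diff[OF of_order_add[OF 2 1] this]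
  show ?thesis by (simp only: left_diff_distrib) simp
qed

lemma \<epsilon>_order: "of_order 1 (\<lambda>p. \<epsilon> p)"
  by (intro of_order_Complex of_order_re_eps of_order_im_eps)

text \<open>From \<open>cmod J = r\<close>, \<open>cmod (1 + \<epsilon>) \<le> 2\<close> and a
  comparison error of order four. The bound makes \<open>J0\<close> nonzero, controls division by
  it, and limits the growth of \<open>ln (cmod J0)\<close>.\<close>

lemma J0_lower: "eventually (\<lambda>p. r p / 4 \<le> cmod (J0 p)) F"
proof -
  obtain C where C: "C > 0" "eventually (\<lambda>p. cmod (J p - J0 p * (1
      + \<epsilon> p)) \<le> C * r p ^ 4) F"
    using J0_approx by (rule of_order_bound)
  have "((\<lambda>p. C * r p ^ 3) \<longlongrightarrow> C * 0 ^ 3) F" by (intro tendsto_intros r_lim)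
  then have "eventually (\<lambda>p. C * r p ^ 3 < 1/2) F" by (rule order_tendstoD) simp
  moreover have "eventually (\<lambda>p. cmod (\<epsilon> p) < 1) F"
    using of_order_tendsto_0[OF \<epsilon>_order] by (intro order_tendstoD(2)[OF tendsto_norm]) auto
  ultimately show ?thesis using C(2) J_norm r
  proof eventually_elim
    case (elim p)
    have "C * r p ^ 4 = (C * r p ^ 3) * r p" by (simp add: eval_nat_numeral)
    also have "\<dots> \<le> (1/2) * r p" using elim by (intro mult_right_mono) auto
    finally have "cmod (J0 p * (1 + \<epsilon> p)) \<ge> r p / 2"
      using elim(3,4) norm_triangle_ineq2[of "J p" "J0 p * (1 + \<epsilon> p)"] by linarith
    moreover have "cmod (1 + \<epsilon> p) \<le> 2" using norm_triangle_ineq[of 1 "\<epsilon> p"]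
        elim(2) by simp
    then have "cmod (J0 p * (1 + \<epsilon> p)) \<le> cmod (J0 p) * 2" unfolding norm_mult by (intro
        mult_left_mono) auto
    ultimately show ?case by linarith
  qed
qed

lemma J0_nonzero: "eventually (\<lambda>p. J0 p \<noteq> 0) F"
  using J0_lower r by eventually_elim auto

text \<open>Division by \<open>J0\<close> costs one order. It is regained in
  \<open>angle_approx\<close>, where the logarithm of the quotient is multiplied by
  \<open>J\<close>, of order one.\<close>

lemma quotient_approx: "of_order 3 (\<lambda>p. J p / J0 p - 1 - \<epsilon> p)"
proof -
  obtain C where C: "C > 0" "eventually (\<lambda>p. cmod (J p - J0 p * (1
      + \<epsilon> p)) \<le> C * r p ^ 4) F"
    using J0_approx by (rule of_order_bound)
  from C(2) J0_lower r have "eventually (\<lambda>p. cmod (J p / J0 p - 1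
      - \<epsilon> p) \<le> (4 * C) * r p ^ 3) F"
  proof eventually_elim
    case (elim p)
    then have nz: "J0 p \<noteq> 0" by auto
    have "J p / J0 p - 1 - \<epsilon> p = (J p - J0 p * (1 + \<epsilon> p)) / J0 p"
      using nz by (simp add: field_simps)
    then have "cmod (J p / J0 p - 1 - \<epsilon> p) = cmod (J p - J0 p * (1 + \<epsilon> p)) / cmod (J0 p)"
      by (simp only: norm_divide)
    also have "\<dots> \<le> (C * r p ^ 4) / (r p / 4)" using elim C(1) by (intro frac_le) auto
    also have "\<dots> = (4 * C) * r p ^ 3" using elim by (simp add: eval_nat_numeral)
    finally show ?case .
  qed
  then show ?thesis by (auto simp: of_order_def)
qed

lemma quotient_order: "of_order 1 (\<lambda>p. J p / J0 p - 1)"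
proof -
  have "of_order 1 (\<lambda>p. (J p / J0 p - 1 - \<epsilon> p) + \<epsilon> p)"
    by (intro of_order_add \<epsilon>_order of_order_mono[OF quotient_approx]) simp
  then show ?thesis by simp
qed

lemma quotient_near_1: "c > 0 \<Longrightarrow> eventually (\<lambda>p. cmod (J p / J0 p - 1) < c) F"
  using of_order_tendsto_0[OF quotient_order] by (intro order_tendstoD(2)[OF tendsto_norm]) auto

lemma Ln_approx: "of_order 3 (\<lambda>p. Ln (J p / J0 p) - Complex (re_log (x p) (y p)) (im_log (x p)
    (y p)))"
proof -
  let ?\<eta> = "\<lambda>p. J p / J0 p - 1"
  have "of_order 3 (\<lambda>p. ?\<eta> p ^ 3)" by (rule of_order_power'[OF quotient_order]) simp
  moreover have "eventually (\<lambda>p. norm (Ln (J p / J0 p) - (?\<eta> p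
      - ?\<eta> p ^ 2/2)) \<le> 2 * norm (?\<eta> p ^ 3)) F"
    using quotient_near_1[of "1/2", simplified]
  proof eventually_elim
    case (elim p)
    then have "cmod (?\<eta> p) \<le> 1/2" by simp
    from norm_Ln_quadratic[OF this] show ?case by (simp add: norm_power)
  qed
  ultimately have 1: "of_order 3 (\<lambda>p. Ln (J p / J0 p) - (?\<eta> p
      - ?\<eta> p ^ 2/2))" by (rule of_order_le)
  have "of_order 0 (\<lambda>p. 1 - (?\<eta> p + \<epsilon> p)/2)"
    by (intro of_order_diff of_order_const of_order_divide_const of_order_add of_order_mono[OF
        \<epsilon>_order]
        of_order_mono[OF quotient_order, unfolded]) simp_all
  from of_order_mult'[OF quotient_approx this, of 3]
  have "of_order 3 (\<lambda>p. (?\<eta> p - \<epsilon> p) * (1 - (?\<eta> p + \<epsilon> p)/2))" by simp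
  moreover have "(w - v) * (1 - (w + v)/2) = (w - w^2/2) - (v - v^2/2)" for w v :: complex
    by (simp add: power2_eq_square field_simps)
  ultimately have 2: "of_order 3 (\<lambda>p. (?\<eta> p - ?\<eta> p ^ 2/2) - (\<epsilon> p
      - \<epsilon> p ^ 2/2))" by (simp only:)
  have "of_order 3 (\<lambda>p. Complex
      (re_eps (x p) (y p) - (re_eps (x p) (y p) ^ 2 - im_eps (x p) (y p) ^ 2) / 2 - re_log (x p) (y p))
      (im_eps (x p) (y p) - re_eps (x p) (y p) * im_eps (x p) (y p) - im_log (x p) (y p)))"
    by (intro of_order_Complex re_log_approx im_log_approx)
  moreover have "Complex (u - (u^2 - v^2)/2 - b) (v - u * v - c) = (Complex u v - Complex u v ^ 2/2)
      - Complex b c" for u v b c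
    by (simp add: complex_eq_iff power2_eq_square)
  ultimately have 3: "of_order 3 (\<lambda>p. (\<epsilon> p - \<epsilon> p ^ 2/2)
      - Complex (re_log (x p) (y p)) (im_log (x p) (y p)))"
    by (simp only:)
  from of_order_trans[OF of_order_trans[OF 1 2] 3] show ?thesis .
qed

lemma angle_approx: "of_order 4 (\<lambda>p. Re (J p * Ln (J p / J0 p)) - angle_poly (x p) (y p))"
proof -
  let ?V = "\<lambda>p. Complex (re_log (x p) (y p)) (im_log (x p) (y p))"
  let ?JP = "\<lambda>p. Complex (A p) (y p)"
  have "of_order 4 (\<lambda>p. Complex (- (A p - a p)) 0)"
    by (intro of_order_Complex of_order_minus of_order_zero of_order_mono[OF action_approx]) simp
  then have "of_order 4 (\<lambda>p. J p - ?JP p)"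
    by (rule of_order_cong) (auto simp: complex_eq_iff intro!: always_eventually)
  moreover have "of_order 1 (\<lambda>p. J p)" by (intro of_order_Complex of_order_a y)
  moreover have "of_order 0 ?V" by (intro of_order_Complex poly_bounded)
  ultimately have "of_order 4 (\<lambda>p. J p * Ln (J p / J0 p) - ?JP p * ?V p)"
    by (intro of_order_mult_approx[OF _ Ln_approx]) (assumption | simp)+
  then have "of_order 4 (\<lambda>p. Re (J p * Ln (J p / J0 p) - ?JP p * ?V p))" by (rule of_order_Re)
  from of_order_add[OF this angle_poly_approx]
  have "of_order 4 (\<lambda>p. Re (J p * Ln (J p / J0 p) - ?JP p * ?V p)
      + (A p * re_log (x p) (y p) - y p * im_log (x p) (y p) - angle_poly (x p) (y p)))" .
  moreover have "Re (z - Complex u v * Complex b c) + (u * b - v * c - w) = Re z - w" for z u v b c w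
    by simp
  ultimately show ?thesis by (simp only:)
qed

section \<open>From the elliptic integral to the action\<close>

abbreviation q where "q p \<equiv> y p * m p ^ 3 / 2"

lemma q_sq: "q p ^ 2 = Q p"
  by (simp add: power_divide power_mult_distrib flip: power_mult)

lemma disc_small: "eventually (\<lambda>p. t p + Q p < 1) F"
proof -
  have "((\<lambda>p. t p + Q p) \<longlongrightarrow> 0 + 0) F" by (intro tendsto_add t_lim Q_lim)
  then show ?thesis by (rule order_tendstoD) simp
qed

text \<open>Rests on \<open>(t + 2 * Q)^2 + 4 * Q * (1 - t - Q) = t^2 + 4 * Q\<close>.\<close>

lemma quad_disc_eq_norm: "eventually (\<lambda>p. quad_disc (t p) (q p) = cmod (J0 p)) F"
  using disc_small
proof eventually_elim
  case (elim p)
  have "(T + 2 * (Y^2 * M^6/4))^2 + (Y * M^3)^2 * (1 - T - Y^2 * M^6/4) = T^2 + 4 * (Y * M^3/2)^2"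
      for T Y M :: real
    by (simp add: eval_nat_numeral field_simps)
  note id = this[of "t p" "y p" "m p"]
  have "s p ^ 2 = 1 - t p - Q p" using elim by simp
  then show ?case
    unfolding quad_disc_def cmod_def complex.sel power_mult_distrib[of _ "s p"] power2_minus by (simp
        only: id)
qed

lemma elliptic_integral_approx:
  "of_order 4 (\<lambda>p. 2 * pi * I1 (h p) (y p) - 2 / m p ^ 3 *
     (sqrt_coeff (t p) (Q p) 1 * s p + log_coeff (t p) (Q p) * (ln (2 - t p + 2 * s p) - ln (cmod (J0 p)))
      - q p * (pi - Arg (J0 p)) + moment_part (t p) (Q p)))"
proof -
  let ?E = "\<lambda>p. elliptic_integral (t p) (q p)"
  let ?S = "\<lambda>p. sqrt_coeff (t p) (Q p) 1 * s p + log_coeff (t p) (Q p) * (ln (2 - t p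
      + 2 * s p) - ln (cmod (J0 p)))
      - q p * (pi - Arg (J0 p)) + moment_part (t p) (Q p)"
  have "of_order 0 (\<lambda>p. m p ^ 3 / 2)" by (intro bounded_intros x_bounded)
  from of_order_mult'[OF y this, of 1] have "of_order 1 q" by simp
  with t_order obtain C where C: "C > 0" "eventually (\<lambda>p. norm (t p) \<le> C * r p ^ 1 \<and>
      norm (q p) \<le> C * r p ^ 1) F"
    by (rule of_order_bound2)
  have "((\<lambda>p. C * r p) \<longlongrightarrow> C * 0) F" by (intro tendsto_intros r_lim)
  then have "eventually (\<lambda>p. C * r p < 1/4) F" by (rule order_tendstoD) simp
  then have ev: "eventually (\<lambda>p. \<bar>?E p - ?S p\<bar> \<le> (100 * C^4) * r p ^ 4 \<and> 2 *
      pi * I1 (h p) (y p) = 2 / m p ^ 3 * ?E p) F"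
    using C(2) quad_disc_eq_norm J0_lower r y_nonneg m_nonzero disc_small parameter
  proof eventually_elim
    case (elim p)
    have \<rho>: "quad_disc (t p) (q p) > 0" using elim by linarith
    have q0: "0 \<le> q p" using elim by simp
    note E = elliptic_integral_expansion[of "t p" "C * r p" "q p", OF _ q0 _ _ \<rho>]
    have z: "J0 p \<noteq> 0" using elim by auto
    have "Im (J0 p) \<ge> 0" using elim by simp
    from arccos_eq_Arg[OF z this] have "arccos ((t p + 2 * Q p) / cmod (J0 p)) = pi - Arg (J0 p)"
      by (simp only: complex.sel minus_minus)
    then have "\<bar>?E p - ?S p\<bar> \<le> 100 * (C * r p)^4"
      using E(2) elim(1,2,3) by (simp only: q_sq real_norm_def power_one_right abs_le_iff)
    moreover have "2 * pi * I1 (h p) (y p) = 2 / m p ^ 3 * ?E p"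
    proof -
      have "m p ^ 2 - 1 = t p" by (simp add: power2_eq_square algebra_simps)
      then show ?thesis
        using I1_eq_elliptic_integral[OF elim(7) elim(9)] E(1) elim(1,2,8)
        by (simp only: q_sq real_norm_def power_one_right abs_le_iff)
    qed
    ultimately show ?case by (simp add: power_mult_distrib)
  qed
  then have "eventually (\<lambda>p. norm (?E p - ?S p) \<le> (100 * C^4) * r p ^ 4) F"
    by eventually_elim simp
  then have "of_order 4 (\<lambda>p. ?E p - ?S p)" unfolding of_order_def by blast
  from of_order_divide_m[OF of_order_cmult[OF this, of 2], of 3] show ?thesis
  proof (rule of_order_cong)
    show "eventually (\<lambda>p. 2 * pi * I1 (h p) (y p) - 2 / m p ^ 3 * ?S p = 2 * (?E p
        - ?S p) / m p ^ 3) F"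
      using ev by eventually_elim (simp only: right_diff_distrib diff_divide_distrib times_divide_eq_left)
  qed
qed

text \<open>The crude bound \<open>- ln N \<le> 1 / N\<close> with \<open>N \<ge> r / 4\<close>
  costs one power of \<open>r\<close>, so a coefficient mismatch of order five leaves order four. A
  mismatch known only to order four would leave an unbounded logarithmic factor.\<close>

lemma ln_norm_error: "of_order 4 (\<lambda>p. (a p - L p) * ln (cmod (J0 p)))"
proof -
  have "of_order 5 (\<lambda>p. (A p - a p) - (L p - A p) - 2 * (A p - a p))"
    by (intro of_order_diff of_order_cmult action_approx log_coeff_approx)
  then have "of_order 5 (\<lambda>p. a p - L p)" by (simp add: algebra_simps)
  then obtain C where C: "C > 0" "eventually (\<lambda>p. norm (a p - L p) \<le> C * r p ^ 5) F"
    by (rule of_order_bound)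
  have "((\<lambda>p. Complex (- (t p + 2 * Q p)) (y p * m p ^ 3 * s p))
        \<longlongrightarrow> Complex (- (0 + 2 * 0)) (0 * (1 + 0) ^ 3 * sqrt (1 - 0 - 0))) F"
    by (intro tendsto_Complex tendsto_minus tendsto_add tendsto_mult tendsto_power tendsto_real_sqrt
          tendsto_diff tendsto_const t_lim Q_lim x_lim y_lim)
  from tendsto_norm[OF this] have "eventually (\<lambda>p. cmod (J0 p) < 1) F"
    by (rule order_tendstoD) (simp add: cmod_def)
  with C(2) J0_lower r have "eventually (\<lambda>p. norm ((a p
      - L p) * ln (cmod (J0 p))) \<le> (4 * C) * r p ^ 4) F"
  proof eventually_elim
    case (elim p)
    define N where "N = cmod (J0 p)"
    have N: "r p / 4 \<le> N" "N < 1" "N > 0" using elim(2-4) unfolding N_def by linarith+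
    have "- ln N = ln (1 / N)" using N by (simp add: ln_div)
    also have "\<dots> \<le> 1 / N" using ln_bound[of "1 / N"] N by simp
    also have "\<dots> \<le> 1 / (r p / 4)" using N elim(3) by (intro divide_left_mono) auto
    finally have "\<bar>ln N\<bar> \<le> 4 / r p" using N by (simp add: abs_if)
    with elim(1) have "\<bar>a p - L p\<bar> * \<bar>ln (cmod (J0 p))\<bar> \<le> (C * r p ^ 5) * (4 / r p)"
      using C(1) elim(3) unfolding N_def by (intro mult_mono) auto
    also have "\<dots> = (4 * C) * r p ^ 4" using elim(3) by (simp add: eval_nat_numeral)
    finally show ?case by (simp only: real_norm_def abs_mult)
  qed
  then show ?thesis unfolding of_order_def by blast
qed

text \<open>Exchanges the singular terms at \<open>J0\<close>, which the integral produces, for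
  those at \<open>J\<close>, which the expansion asks for.\<close>

lemma Re_log_difference:
  "eventually (\<lambda>p. Re (J p * Ln (J p / J0 p))
     = a p * (ln (cmod (J p)) - ln (cmod (J0 p))) - y p * (Arg (J p) - Arg (J0 p))) F"
  using J_norm r J0_nonzero y_nonneg m_nonzero disc_small quotient_near_1[OF zero_less_one]
proof eventually_elim
  case (elim p)
  have J: "J p \<noteq> 0" "Im (J p) \<ge> 0" using elim by auto
  have J0: "J0 p \<noteq> 0" "Im (J0 p) \<ge> 0" using elim by auto
  have "Ln (J p / J0 p) = Ln (J p) - Ln (J0 p)"
    by (rule Ln_divide_upper_half_plane[OF J J0 elim(7)])
  then show ?case using J(1) J0(1) by (simp add: Arg_eq_Im_Ln)
qed

lemma action_expansion:
  "of_order 4 (\<lambda>p. 2 * pi * I1 (h p) (y p)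
     - (4/3 - pi * y p + y p * Arg (J p) - a p * ln (cmod (J p)) + a p)
     - (a p * ln 16 + (17 * a p ^ 2 + 3 * y p ^ 2)/16 - a p * (125 * a p ^ 2 + 43 * y p ^ 2)/128))"
proof -
  let ?w = "\<lambda>p. (2 * s p - 2 - t p) / 4"
  let ?lw = "\<lambda>p. ln (1 + ?w p)"
  let ?lam = "\<lambda>p. log_poly (x p) (y p)" and ?W = "\<lambda>p. angle_poly (x p) (y p)"
  let ?p3 = "\<lambda>p. coeff_poly (x p) (y p)" and ?mp = "\<lambda>p. moment_poly (x p) (y p)"
  let ?sg = "\<lambda>p. sqrt_poly (x p) (y p)"
  let ?X = "\<lambda>p. 2 * pi * I1 (h p) (y p) - 2 / m p ^ 3 *
     (sqrt_coeff (t p) (Q p) 1 * s p + log_coeff (t p) (Q p) * (ln (2 - t p + 2 * s p) - ln (cmod (J0 p)))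
      - q p * (pi - Arg (J0 p)) + moment_part (t p) (Q p))"
  let ?P = "\<lambda>p. 2 * (?p3 p * ?sg p + ?mp p) - m p ^ 3 * (4/3) + m p ^ 3 * (A p * ?lam p
      - 2 * ln 2 * A p - A p
     - ((17 * A2 p + 3 * y p ^ 2)/16 - (125 * A3 p + 43 * A p * y p ^ 2)/128) + ?W p)"
  have e1: "of_order 4 (\<lambda>p. sqrt_coeff (t p) (Q p) 1 * s p - ?p3 p * ?sg p)"
  proof -
    \<comment> \<open>\<open>sqrt_coeff\<close> at \<open>u = 1\<close> is affine in
      \<open>Q\<close>; this is its slope. The same device handles \<open>moment_part\<close>
      next.\<close>
    have "of_order 0 (\<lambda>p. 1/24 + 13/768 * t p + 1/128)" by (intro bounded_intros x_bounded)
    from of_order_mult'[OF disc_poly_approx this, of 4]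
    have "of_order 4 (\<lambda>p. (Q p - Q5 p) * (1/24 + 13/768 * t p + 1/128))" by simp
    moreover have "(Q' - Q'') * (1/24 + 13/768 * T + 1/128) = sqrt_coeff T Q' 1
        - sqrt_coeff T Q'' 1" for T Q' Q''
      unfolding sqrt_coeff_def by (simp add: field_simps)
    ultimately have "of_order 4 (\<lambda>p. sqrt_coeff (t p) (Q p) 1
        - sqrt_coeff (t p) (Q5 p) 1)" by (simp only:)
    from of_order_trans[OF this coeff_poly_approx]
    have "of_order 4 (\<lambda>p. sqrt_coeff (t p) (Q p) 1 - ?p3 p)" .
    moreover have "of_order 0 (\<lambda>p. sqrt_coeff (t p) (Q p) 1)"
      unfolding sqrt_coeff_def by (intro bounded_intros x_bounded y_bounded)
    ultimately show ?thesis
      by (intro of_order_mult_approx[OF _ sqrt_approx _ poly_bounded(3)]) (assumption | simp)+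
  qed
  have e2: "of_order 4 (\<lambda>p. moment_part (t p) (Q p) - ?mp p)"
  proof -
    have "of_order 0 (\<lambda>p. - (21/32 - ln 2)/2 - t p/4 * (1/8 - ln 2/4))"
      by (intro bounded_intros x_bounded)
    from of_order_mult'[OF disc_poly_approx this, of 4]
    have "of_order 4 (\<lambda>p. (Q p - Q5 p) * (- (21/32 - ln 2)/2 - t p/4 * (1/8 - ln 2/4)))" by simp
    moreover have "(Q' - Q'') * (- (21/32 - ln 2)/2 - T/4 * (1/8 - ln 2/4)) = moment_part T Q'
        - moment_part T Q''" for T Q' Q''
      unfolding moment_part_def by (simp add: field_simps)
    ultimately have "of_order 4 (\<lambda>p. moment_part (t p) (Q p)
        - moment_part (t p) (Q5 p))" by (simp only:)
    from of_order_trans[OF this moment_poly_approx] show ?thesis .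
  qed
  have e3: "of_order 4 (\<lambda>p. L p * ?lw p - A p * ?lam p)"
    by (intro of_order_mult_approx[OF log_coeff_approx ln_approx of_order_log_coeff poly_bounded(10)]) auto
  have e4: "of_order 4 (\<lambda>p. (17 * a p ^ 2 + 3 * y p ^ 2)/16 - a p * (125 * a p ^ 2
      + 43 * y p ^ 2)/128
     - ((17 * A2 p + 3 * y p ^ 2)/16 - (125 * A3 p + 43 * A p * y p ^ 2)/128))"
  proof -
    let ?c = "\<lambda>p. - 17/16 * (A p + a p) + 125/128 * (A p ^ 2 + A p * a p + a p ^ 2)
        + 43/128 * y p ^ 2"
    let ?e2 = "\<lambda>p. A p * A p - A2 p" and ?e3 = "\<lambda>p. A p * A2 p - A3 p"
    have a0: "of_order 0 a" by (rule of_order_mono[OF of_order_a]) simp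
    have c: "of_order 0 ?c" "of_order 0 (\<lambda>p. 17/16 - 125/128 * A p)"
      by (intro bounded_intros x_bounded y_bounded A_bounded a0)+
    have "of_order 4 (\<lambda>p. (A p - a p) * ?c p + ?e2 p * (17/16 - 125/128 * A p) - 125/128 * ?e3 p)"
      by (rule of_order_diff[OF of_order_add[OF of_order_mult'[OF action_approx c(1)]
            of_order_mult'[OF action_poly_square_approx c(2)]] of_order_cmult[OF of_order_mono[OF
                action_poly_cube_approx]]]) auto
    moreover have "(u - v) * (- 17/16 * (u + v) + 125/128 * (u ^ 2 + u * v + v ^ 2) + 43/128 * z ^ 2)
       + (u * u - b) * (17/16 - 125/128 * u) - 125/128 * (u * b - c)
       = (17 * v ^ 2 + 3 * z ^ 2)/16 - v * (125 * v ^ 2 + 43 * z ^ 2)/128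
     - ((17 * b + 3 * z ^ 2)/16 - (125 * c + 43 * u * z ^ 2)/128)" for u v z b c :: real
      by (simp add: eval_nat_numeral field_simps)
    ultimately show ?thesis by (simp only:)
  qed
  \<comment> \<open>The cost of writing \<open>A\<close> for \<open>a\<close> in
    \<open>- a - a * ln 16\<close> and for \<open>L\<close> in the \<open>2 * ln 2 * L\<close> split
    off the logarithm.\<close>
  have e5: "of_order 4 (\<lambda>p. (1 + 4 * ln 2) * (A p - a p) + 2 * ln 2 * (L p - A p))"
    by (intro of_order_add of_order_cmult of_order_mono[OF action_approx] of_order_mono[OF
        log_coeff_approx]) auto
  have "of_order 4 (\<lambda>p. (?P p + 2 * (sqrt_coeff (t p) (Q p) 1 * s p - ?p3 p * ?sg p)
      + 2 * (moment_part (t p) (Q p) - ?mp p)) / m p ^ 3)"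
    by (rule of_order_divide_m[OF of_order_add[OF of_order_add[OF expansion_poly_cancels
        of_order_cmult[OF e1]] of_order_cmult[OF e2]]])
  note main = of_order_add[OF of_order_add[OF of_order_diff[OF of_order_add[OF of_order_add[OF
      of_order_add[OF
     elliptic_integral_approx this] e3] e5] e4] angle_approx] ln_norm_error]
  show ?thesis
  proof (rule of_order_cong[OF main])
    have w: "(?w \<longlongrightarrow> (2 * sqrt (1 - 0 - 0) - 2 - 0) / 4) F"
      by (intro tendsto_intros t_lim Q_lim) auto
    then have "eventually (\<lambda>p. ?w p > - 1) F" by (rule order_tendstoD) simp
    with Re_log_difference m_nonzero
    show "eventually (\<lambda>p. 2 * pi * I1 (h p) (y p)
     - (4/3 - pi * y p + y p * Arg (J p) - a p * ln (cmod (J p)) + a p)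
     - (a p * ln 16 + (17 * a p ^ 2 + 3 * y p ^ 2)/16 - a p * (125 * a p ^ 2 + 43 * y p ^ 2)/128)
     = ?X p + (?P p + 2 * (sqrt_coeff (t p) (Q p) 1 * s p - ?p3 p * ?sg p)
         + 2 * (moment_part (t p) (Q p) - ?mp p)) / m p ^ 3
       + (L p * ?lw p - A p * ?lam p) + ((1 + 4 * ln 2) * (A p - a p) + 2 * ln 2 * (L p - A p))
       - ((17 * a p ^ 2 + 3 * y p ^ 2)/16 - a p * (125 * a p ^ 2 + 43 * y p ^ 2)/128
     - ((17 * A2 p + 3 * y p ^ 2)/16 - (125 * A3 p + 43 * A p * y p ^ 2)/128))
       + (Re (J p * Ln (J p / J0 p)) - ?W p) + (a p - L p) * ln (cmod (J0 p))) F"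
    proof eventually_elim
      case (elim p)
      have "2 - T + 2 * S = 4 * (1 + (2 * S - 2 - T) / 4)" for T S :: real by (simp add: field_simps)
      then have "ln (2 - t p + 2 * s p) = ln (4 * (1 + ?w p))" by (simp only:)
      also have "\<dots> = ln 4 + ?lw p" by (rule ln_mult_pos) (use elim(3) in linarith)+
      also have "ln (4 :: real) = 2 * ln 2" using ln_realpow[of 2 2] by simp
      finally have l: "ln (2 - t p + 2 * s p) = 2 * ln 2 + ?lw p" .
      have l16: "ln (16 :: real) = 4 * ln 2" using ln_realpow[of 2 4] by simp
      \<comment> \<open>Here \<open>M\<close> is \<open>m^3\<close> and \<open>c\<close> is
        \<open>log_coeff\<close>. Since \<open>2 / M * q = y\<close>, the angle term of the integral
        supplies \<open>- pi * y\<close> together with \<open>y * Arg J0\<close>.\<close>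
      have id: "I - (4/3 - pi * Y + Y * \<theta> - a' * lj + a') - (a' * (4 * l2) + U - V)
        = (I - 2 / M * (c1 * s' + c * ((2 * l2 + lw') - l0) - (Y * M / 2) * (pi - \<theta>0) + mp'))
          + ((2 * (p3' * sg' + mpp) - M * (4/3) + M * (A' * lam' - 2 * l2 * A' - A' - S2 + W'))
              + 2 * (c1 * s' - p3' * sg') + 2 * (mp' - mpp)) / M
          + ((2 * c / M) * lw' - A' * lam') + ((1 + 4 * l2) * (A' - a') + 2 * l2 * ((2 * c / M) - A'))
          - (U - V - S2) + ((a' * (lj - l0) - Y * (\<theta> - \<theta>0)) - W') + (a' - (2 * c / M)) * l0"
        if "M \<noteq> 0" for I Y \<theta> a' lj l2 U V S2 M c1 s' c lw' l0 \<theta>0 mp' p3' sg' mpp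
            A' lam' W' :: real
        using that by (simp add: field_simps)
      have M: "m p ^ 3 \<noteq> 0" using elim(2) by simp
      show ?case unfolding elim(1) l l16 by (rule id[OF M])
    qed
  qed
qed

end

section \<open>Evenness in \<open>j2\<close> and the limit at the origin\<close>

lemma I1_abs: "I1 h \<bar>b\<bar> = I1 h b"
proof -
  have "Pcub h \<bar>b\<bar> = Pcub h b" by (simp add: Pcub_def fun_eq_iff)
  then show ?thesis by (simp add: I1_def zroot2_def zroot3_def)
qed

lemma abs_mult_Arg: "\<bar>b\<bar> * Arg (Complex a \<bar>b\<bar>) = b * Arg (Complex a b)"
proof (cases "b \<ge> 0")
  case False
  then have "Arg (cnj (Complex a b)) = - Arg (Complex a b)"
    by (simp add: Arg_cnj complex_is_Real_iff)
  moreover have "cnj (Complex a b) = Complex a (- b)" by (simp add: complex_eq_iff)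
  ultimately show ?thesis using False by simp
qed simp

lemma Hbar5_abs: "Hbar5 a \<bar>b\<bar> = Hbar5 a b"
  by (simp add: Hbar5_def)

lemma scale_norm: "scale (at ((0::real), (0::real))) norm"
proof
  show "eventually (\<lambda>p. 0 < norm p) (at (0::real, 0::real))"
    unfolding eventually_at by (intro exI[of _ 1]) (auto simp: zero_prod_def)
  have "(norm \<longlongrightarrow> norm (0::real, 0::real)) (at (0::real, 0::real))"
    by (rule tendsto_norm[OF tendsto_ident_at])
  then show "(norm \<longlongrightarrow> 0) (at (0::real, 0::real))" by (simp add: zero_prod_def[symmetric])
qed

theorem theorem4:
  fixes Hbar :: "real \<Rightarrow> real \<Rightarrow> real"
  assumes "(\<lambda>(a::real, b::real). Hbar a b - Hbar5 a b) \<in> O[at (0,0)](\<lambda>(a, b). norm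
      (a, b) ^ 6)"
  shows "(\<lambda>(a::real, b::real). Sinv Hbar a b
            - (a * ln 16 + (17*a^2 + 3*b^2)/16 - a*(125*a^2 + 43*b^2)/128))
         \<in> O[at (0,0)](\<lambda>(a, b). norm (a, b) ^ 4)"
proof -
  let ?F = "at (0::real, 0::real)"
  interpret scale ?F norm by (rule scale_norm)
  define h where "h = (\<lambda>p :: real \<times> real. Hbar (fst p) (snd p))"
  have "of_order 6 (\<lambda>p. h p - Hbar5 (fst p) (snd p))"
    unfolding of_order_iff_bigo using assms by (simp add: h_def case_prod_beta')
  then have energy: "of_order 5 (\<lambda>p. h p - Hbar5 (fst p) \<bar>snd p\<bar>)"
    unfolding Hbar5_abs by (rule of_order_mono) simp
  have comp: "\<bar>fst p\<bar> \<le> norm p" "\<bar>snd p\<bar> \<le> norm p" for p :: "real \<times> real"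
    using norm_fst_le[of "fst p" "snd p"] norm_snd_le[of "snd p" "fst p"] by simp_all
  have h_le: "eventually (\<lambda>p. \<bar>h p\<bar> \<le> 2 * norm p) ?F"
  proof -
    obtain C where C: "C > 0" "eventually (\<lambda>p. norm (h p
        - Hbar5 (fst p) \<bar>snd p\<bar>) \<le> C * norm p ^ 5) ?F"
      using energy by (rule of_order_bound)
    \<comment> \<open>The normal form is \<open>a + a * ?f a b + b * ?g b\<close> with
      \<open>?f\<close> and \<open>?g\<close> vanishing at the origin. These two corrections and the
      error of the normal form each cost at most \<open>norm p / 3\<close>, so
      \<open>\<bar>h p\<bar> \<le> 2 * norm p\<close>, as \<open>energy_parameter_exists\<close>
      requires.\<close>
    let ?f = "\<lambda>a b. 3 * a/8 - (17 * a^2 + 9 * b^2)/64 + (375 * a^3 + 258 * a * b^2)/1024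
      - (10689 * a^4 + 8910 * a^2 * b^2 + 909 * b^4)/16384"
    let ?g = "\<lambda>b. b/8 + 11 * b^3/1024"
    have fst: "((\<lambda>p. fst p) \<longlongrightarrow> 0) ?F" and snd: "((\<lambda>p. snd p)
        \<longlongrightarrow> 0) ?F"
      using tendsto_fst[OF tendsto_ident_at, of "(0::real, 0::real)"] tendsto_snd[OF tendsto_ident_at,
          of "(0::real, 0::real)"]
      by simp_all
    have "((\<lambda>p. ?f (fst p) (snd p)) \<longlongrightarrow> ?f 0 0) ?F" "((\<lambda>p. ?g (snd
        p)) \<longlongrightarrow> ?g 0) ?F"
      by (intro tendsto_intros fst snd; simp)+
    then have fg: "((\<lambda>p. \<bar>?f (fst p) (snd p)\<bar>) \<longlongrightarrow> 0) ?F"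
        "((\<lambda>p. \<bar>?g (snd p)\<bar>) \<longlongrightarrow> 0) ?F"
      by (auto intro!: tendsto_rabs_zero)
    have "eventually (\<lambda>p. \<bar>?f (fst p) (snd p)\<bar> < 1/3) ?F" "eventually (\<lambda>p.
        \<bar>?g (snd p)\<bar> < 1/3) ?F"
      by (rule order_tendstoD(2)[OF fg(1)], simp, rule order_tendstoD(2)[OF fg(2)], simp)
    moreover have "((\<lambda>p. C * norm p ^ 4) \<longlongrightarrow> C * 0 ^ 4) ?F" by (intro
        tendsto_intros r_lim)
    then have "eventually (\<lambda>p. C * norm p ^ 4 < 1/3) ?F" by (rule order_tendstoD) simp
    ultimately show ?thesis using C(2)
    proof eventually_elim
      case (elim p)
      have "C * norm p ^ 5 = (C * norm p ^ 4) * norm p" by (simp add: eval_nat_numeral)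
      also have "\<dots> \<le> (1/3) * norm p" using elim by (intro mult_right_mono) auto
      finally have 1: "\<bar>h p - Hbar5 (fst p) (snd p)\<bar> \<le> norm p / 3" using elim(4) by (simp
          add: Hbar5_abs)
      have 2: "\<bar>fst p * ?f (fst p) (snd p)\<bar> \<le> norm p * (1/3)"
        unfolding abs_mult using elim(1) comp(1)[of p] by (intro mult_mono) auto
      have 3: "\<bar>snd p * ?g (snd p)\<bar> \<le> norm p * (1/3)"
        unfolding abs_mult using elim(2) comp(2)[of p] by (intro mult_mono) auto
      have "Hbar5 a b = a + a * ?f a b + b * ?g b" for a b
        unfolding Hbar5_def by (simp add: eval_nat_numeral field_simps)
      from this[of "fst p" "snd p"] 1 2 3 comp(1)[of p] show ?case by linarith
    qed
  qed
  have "eventually (\<lambda>p. \<exists>m. \<bar>m - 1\<bar> \<le> 4 * norm p \<and> h p = (1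
      - m^2)/m^4 + (snd p)^2 * m^2/4) ?F"
    using h_le r_less[of "1/100", simplified]
    by eventually_elim (intro energy_parameter_exists comp; simp)
  \<comment> \<open>A pointwise choice of the parameter; the bound on \<open>m - 1\<close> supplies
    its order.\<close>
  then obtain m where m: "eventually (\<lambda>p. \<bar>m p - 1\<bar> \<le> 4 * norm p \<and> h p
      = (1 - m p^2)/m p^4 + (snd p)^2 * m p^2/4) ?F"
    unfolding eventually_ex by blast
  have m1: "eventually (\<lambda>p. norm (m p - 1) \<le> 4 * norm p ^ 1) ?F"
    using m by eventually_elim simp
  interpret champagne_asymptotics ?F norm "\<lambda>p. m p - 1" "\<lambda>p. \<bar>snd p\<bar>" fst h
  proof
    show "of_order 1 (\<lambda>p. m p - 1)" unfolding of_order_def using m1 by blast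
    show "of_order 1 (\<lambda>p. \<bar>snd p\<bar> :: real)"
      unfolding of_order_def using comp(2) by (intro exI[of _ 1] always_eventually) simp
    show "eventually (\<lambda>p. norm p = sqrt (fst p ^ 2 + \<bar>snd p\<bar> ^ 2)) ?F"
      by (simp add: norm_prod_def)
    show "eventually (\<lambda>p. h p = (1 - (1 + (m p - 1))^2) / (1 + (m p - 1))^4
        + \<bar>snd p\<bar>^2 * (1 + (m p - 1))^2 / 4) ?F"
      using m by eventually_elim simp
  qed (use energy in simp_all)
  have "2 * pi * I1 (h p) \<bar>snd p\<bar>
     - (4/3 - pi * \<bar>snd p\<bar> + \<bar>snd p\<bar> * Arg (Complex (fst p) \<bar>snd p\<bar>)
         - fst p * ln (cmod (Complex (fst p) \<bar>snd p\<bar>)) + fst p)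
     = Sinv Hbar (fst p) (snd p)" for p
    unfolding I1_abs abs_mult_Arg by (simp add: Sinv_def h_def cmod_def)
  with action_expansion have "of_order 4 (\<lambda>p. Sinv Hbar (fst p) (snd p)
     - (fst p * ln 16 + (17 * fst p ^ 2 + 3 * snd p ^ 2)/16 - fst p * (125 * fst p ^ 2
         + 43 * snd p ^ 2)/128))"
    by (simp only: power2_abs)
  then show ?thesis unfolding of_order_iff_bigo by (simp add: case_prod_beta')
qed

end
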